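(* Let $\ell_0>0$ and $(y_0,y_1)\in C^1([0,\ell_0])\times C^0([0,\ell_0])$ satisfy $$y_0(\ell_0)=0,\qquad y_1(\ell_0)=-\max\left[\frac{\frac12(y_1(\ell_0)-y_0'(\ell_0))^2-\kappa(\ell_0)}{\frac12(y_1(\ell_0)-y_0'(\ell_0))^2+\kappa(\ell_0)},\,0\right]y_0'(\ell_0),$$ and let $\ell_\ast,\ell_\ast'$ be the size and speed at the end of the initial branch determined by $(\ell_0,y_0,y_1)$. Let $T>0$, $\bar\ell_0>0$ and $(\bar y_0,\bar y_1)\in C^1([0,\bar\ell_0])\times C^0([0,\bar\ell_0])$ satisfy: - $\bar\ell_0\ge\ell_\ast$ if $\ell_\ast'=0$, and $\bar\ell_0>\ell_\ast$ otherwise; - $T>2\bar\ell_0$; - $\bar y_0(\bar\ell_0)=\bar y_1(\bar\ell_0)=0$ and $\|\bar y_1+\bar y_0'\|_{L^\infty([0,\bar\ell_0])}^2\le 2\,\kappa(\bar\ell_0)$. Then there exists a control $u\in C^1([0,T])$ such that the $C^1$-solution $(\ell,y)$ on $[0,T]$ of the debonding system with data $(\ell_0,y_0,y_1)$ and control $u$ satisfies $$\ell(T)=\bar\ell_0,\qquad y(T,\cdot)=\bar y_0,\qquad \partial_t y(T,\cdot)=\bar y_1 .$$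
   Context: Fix $0<c_1<c_2$ and a locally Lipschitz function $\kappa:[0,\infty)\to[c_1,c_2]$. Debonding system. Given $\ell_0>0$, $(y_0,y_1)$ on $[0,\ell_0]$ and a control $u$ on $[0,T]$, the unknowns are the front $\ell:[0,T]\to(0,\infty)$ and the displacement $y$ on $\{0\le t\le T,\ 0\le x\le \ell(t)\}$. The equations are $\partial_{tt}^2y-\partial_{xx}^2y=0$ for $0<x<\ell(t)$; $y(t,0)=u(t)$; $y(t,\ell(t))=0$; $y(0,\cdot)=y_0$; $\partial_ty(0,\cdot)=y_1$; together with Griffith's criterion $\ell'\ge0$, $G_{\ell'(t)}(t)\le\kappa(\ell(t))$, $\ell'(t)[G_{\ell'(t)}(t)-\kappa(\ell(t))]=0$, $\ell(0)=\ell_0$, where $G_{\ell'(t)}(t)=\frac12(1-\ell'(t)^2)(\partial_xy(t,\ell(t)))^2$. Solutions are understood through the following equivalent formulation. Put $\tau_\pm(t)=t\pm\ell(t)$ (strictly increasing). There is $f:[-\ell_0,T]\to\mathbb R$ with (1) $f(s)=\frac12\int_0^{-s}(y_0'-y_1)(\sigma)\,d\sigma$ for $s\in[-\ell_0,0]$; $f(s)=u(s)-u(0)-\frac12\int_0^s(y_0'+y_1)(\sigma)\,d\sigma$ for $s\in(0,\ell_0]$, $s\le T$; $f(s)=u(s)+f(\tau_-(\tau_+^{-1}(s)))$ for $s\in(\ell_0,T]$; (2) $\ell(0)=\ell_0$ and $\ell'(t)=\max\Big[\frac{2f'(t-\ell(t))^2-\kappa(\ell(t))}{2f'(t-\ell(t))^2+\kappa(\ell(t))},0\Big]$;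 (3) $y(t,x)=f(t-x)-g(t+x)$, where $g(s)=-u(0)-\frac12\int_0^s(y_0'+y_1)(\sigma)\,d\sigma$ for $0\le s\le\ell_0$ and $g(s)=f(\tau_-(\tau_+^{-1}(s)))$ for $\ell_0<s\le T+\ell(T)$ (i.e. $y(t,x)=u(t+x)-f(t+x)+f(t-x)$). A $C^1$-solution on $[0,T]$ is one with $\ell\in C^1([0,T])$, $y\in C^1(\{0\le t\le T,0\le x\le\ell(t)\})$, $f\in C^1([-\ell_0,T])$; all identities then hold pointwise. Derivatives in $t$ at $t=T$ are one-sided. Initial branch. Until the time $t_\ast$ at which $t-\ell(t)=0$, $\ell$ depends only on $(\ell_0,y_0,y_1)$: it solves $\ell(0)=\ell_0$, $\ell'(t)=\max\Big[\frac{\frac12 w^2-\kappa(\ell(t))}{\frac12 w^2+\kappa(\ell(t))},0\Big]$ with $w=(y_1-y_0')(\ell(t)-t)$. Define $t_\ast$ as the time with $\ell(t_\ast)=t_\ast$, and $\ell_\ast:=\ell(t_\ast)=t_\ast$, $\ell_\ast':=\ell'(t_\ast)$. *)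

theory Defs
  imports "HOL-Analysis.Analysis" "HOL-Probability.Essential_Supremum"
begin

text \<open>
  Functions on intervals are total functions of which only the values on the interval matter.
  Derivatives are taken within the interval, hence are one-sided at its endpoints.  (The library
  predicate \<open>C1_differentiable_on\<close> asks for two-sided derivatives instead.)
\<close>

abbreviation deriv_on :: "real set \<Rightarrow> (real \<Rightarrow> real) \<Rightarrow> real \<Rightarrow> real" where
  "deriv_on S f x \<equiv> vector_derivative f (at x within S)"

definition C1_on :: "real set \<Rightarrow> (real \<Rightarrow> real) \<Rightarrow> bool" where
  "C1_on S f \<longleftrightarrow>
     (\<exists>f'. (\<forall>x\<in>S. (f has_real_derivative f' x) (at x within S)) \<and> continuous_on S f')"

definition C1_on_plane :: "(real \<times> real) set \<Rightarrow> (real \<Rightarrow> real \<Rightarrow> real) \<Rightarrow> bool" where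
  "C1_on_plane D y \<longleftrightarrow>
     (\<exists>yt yx. (\<forall>p\<in>D. ((\<lambda>(t, x). y t x) has_derivative (\<lambda>(h, k). yt p * h + yx p * k)) (at p within D))
        \<and> continuous_on D yt \<and> continuous_on D yx)"

text \<open>
  The time derivative is a component of the total derivative within the domain: where a moving
  front ends, at \<open>(T, L T)\<close>, the domain contains no segment in the direction of \<open>t\<close>, so that
  a derivative of \<open>\<lambda>t. y t x\<close> alone would not be determined there.
\<close>

definition partial_t :: "(real \<times> real) set \<Rightarrow> (real \<Rightarrow> real \<Rightarrow> real) \<Rightarrow> real \<Rightarrow> real \<Rightarrow> real" where
  "partial_t D y t x = frechet_derivative (\<lambda>(t, x). y t x) (at (t, x) within D) (1, 0)"

definition Linf_norm_on :: "real set \<Rightarrow> (real \<Rightarrow> real) \<Rightarrow> ereal" where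
  "Linf_norm_on S f = esssup (lebesgue_on S) (\<lambda>x. ereal \<bar>f x\<bar>)"

definition locally_Lipschitz_on :: "real set \<Rightarrow> (real \<Rightarrow> real) \<Rightarrow> bool" where
  "locally_Lipschitz_on S f \<longleftrightarrow> (\<forall>x\<in>S. \<exists>\<epsilon>>0. \<exists>C. C-lipschitz_on (cball x \<epsilon> \<inter> S) f)"

text \<open>
  Front speed given by Griffith's criterion; \<open>q\<close> is \<open>2 f'(t - \<ell>(t))\<^sup>2\<close>, which on the
  initial branch is \<open>w\<^sup>2 / 2\<close>, and \<open>k\<close> is the toughness \<open>\<kappa>(\<ell>(t))\<close>.
\<close>

definition front_speed :: "real \<Rightarrow> real \<Rightarrow> real" where
  "front_speed q k = max ((q - k) / (q + k)) 0"

definition debonding_domain :: "real \<Rightarrow> (real \<Rightarrow> real) \<Rightarrow> (real \<times> real) set" where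
  "debonding_domain T L = {(t, x). 0 \<le> t \<and> t \<le> T \<and> 0 \<le> x \<and> x \<le> L t}"

text \<open>The map \<open>\<tau>\<^sub>- \<circ> \<tau>\<^sub>+\<inverse>\<close> with \<open>\<tau>\<^sub>\<plusminus>(t) = t \<plusminus> \<ell>(t)\<close> on \<open>[0, T]\<close>.\<close>

definition reflect :: "real \<Rightarrow> (real \<Rightarrow> real) \<Rightarrow> real \<Rightarrow> real" where
  "reflect T L s = (let t = the_inv_into {0..T} (\<lambda>t. t + L t) s in t - L t)"

definition wave_f_eqs ::
  "real \<Rightarrow> real \<Rightarrow> (real \<Rightarrow> real) \<Rightarrow> (real \<Rightarrow> real) \<Rightarrow> (real \<Rightarrow> real) \<Rightarrow> (real \<Rightarrow> real) \<Rightarrow> (real \<Rightarrow> real) \<Rightarrow> bool"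
where
  "wave_f_eqs T l0 y0 y1 u L f \<longleftrightarrow>
     (\<forall>s\<in>{-l0..0}. f s = 1/2 * integral {0..-s} (\<lambda>\<sigma>. deriv_on {0..l0} y0 \<sigma> - y1 \<sigma>)) \<and>
     (\<forall>s\<in>{0<..l0}. s \<le> T \<longrightarrow>
        f s = u s - u 0 - 1/2 * integral {0..s} (\<lambda>\<sigma>. deriv_on {0..l0} y0 \<sigma> + y1 \<sigma>)) \<and>
     (\<forall>s\<in>{l0<..T}. f s = u s + f (reflect T L s))"

definition wave_g ::
  "real \<Rightarrow> real \<Rightarrow> (real \<Rightarrow> real) \<Rightarrow> (real \<Rightarrow> real) \<Rightarrow> (real \<Rightarrow> real) \<Rightarrow> (real \<Rightarrow> real) \<Rightarrow> (real \<Rightarrow> real) \<Rightarrow> real \<Rightarrow> real"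
where
  "wave_g T l0 y0 y1 u L f s =
     (if s \<le> l0 then - u 0 - 1/2 * integral {0..s} (\<lambda>\<sigma>. deriv_on {0..l0} y0 \<sigma> + y1 \<sigma>)
      else f (reflect T L s))"

text \<open>
  \<open>L\<close> is the front and \<open>y\<close> the displacement.  The boundary conditions
  \<open>y(t,0) = u(t)\<close> and \<open>y(t,L(t)) = 0\<close> are contained in the equations for \<open>f\<close> and \<open>y\<close>.
  If \<open>y0(l0) = 0\<close> and \<open>T > l0\<close>, continuity of \<open>f\<close> at \<open>l0\<close> forces \<open>u(0) = y0(0)\<close>, and this
  gives the initial conditions.
\<close>

definition C1_debonding_solution ::
  "(real \<Rightarrow> real) \<Rightarrow> real \<Rightarrow> real \<Rightarrow> (real \<Rightarrow> real) \<Rightarrow> (real \<Rightarrow> real) \<Rightarrow> (real \<Rightarrow> real)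
    \<Rightarrow> (real \<Rightarrow> real) \<Rightarrow> (real \<Rightarrow> real \<Rightarrow> real) \<Rightarrow> bool"
where
  "C1_debonding_solution \<kappa> T l0 y0 y1 u L y \<longleftrightarrow>
     (\<forall>t\<in>{0..T}. 0 < L t) \<and> C1_on {0..T} L \<and> C1_on_plane (debonding_domain T L) y \<and>
     (\<exists>f. C1_on {-l0..T} f \<and> wave_f_eqs T l0 y0 y1 u L f \<and>
        L 0 = l0 \<and>
        (\<forall>t\<in>{0..T}. deriv_on {0..T} L t
            = front_speed (2 * (deriv_on {-l0..T} f (t - L t))\<^sup>2) (\<kappa> (L t))) \<and>
        (\<forall>(t, x)\<in>debonding_domain T L. y t x = f (t - x) - wave_g T l0 y0 y1 u L f (t + x)))"

text \<open>
  \<open>ls\<close> and \<open>ls'\<close> are the length and the speed of the front at the end of the initial branch,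
  the time \<open>ts\<close> with \<open>L(ts) = ts\<close>.  The speed lies in \<open>[0,1)\<close>, so \<open>L(t) - t\<close> stays in
  \<open>[0,l0]\<close> up to \<open>ts\<close>.
\<close>

definition initial_branch_end ::
  "(real \<Rightarrow> real) \<Rightarrow> real \<Rightarrow> (real \<Rightarrow> real) \<Rightarrow> (real \<Rightarrow> real) \<Rightarrow> real \<Rightarrow> real \<Rightarrow> bool"
where
  "initial_branch_end \<kappa> l0 y0 y1 ls ls' \<longleftrightarrow>
     (\<exists>L ts. 0 < ts \<and> L 0 = l0 \<and>
        (\<forall>t\<in>{0..ts}. (L has_real_derivative
            front_speed (1/2 * (y1 (L t - t) - deriv_on {0..l0} y0 (L t - t))\<^sup>2) (\<kappa> (L t)))
            (at t within {0..ts})) \<and>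
        L ts = ts \<and> ls = L ts \<and> ls' = deriv_on {0..ts} L ts)"

end

theory Submission
  imports Defs
begin

text \<open>
  Reversing time, the target state prescribes \<open>f'\<close> on \<open>[T - 2 lb0, T]\<close> if the front rests at \<open>lb0\<close>
  during \<open>[T - lb0, T]\<close>, and the bound on \<open>yb1 + yb0'\<close> is exactly what Griffith's criterion needs
  for the front to rest. In between, any \<open>C\<^sup>1\<close> motion with speed in \<open>[0, 1)\<close> is admissible: a front
  moving at speed \<open>V\<close> requires \<open>f'(t - L t) = q * sqrt (\<kappa> (L t) (1 + V) / (2 (1 - V)))\<close> with
  \<open>\<bar>q\<bar> = 1\<close> where \<open>V \<noteq> 0\<close> and \<open>\<bar>q\<bar> \<le> 1\<close> where \<open>V = 0\<close>. As \<open>T > 2 lb0\<close>, the average speed needed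
  from the end of the initial branch to \<open>(T - lb0, lb0)\<close> is less than \<open>1\<close>, and short rests leave room to
  adjust \<open>q\<close> to the data at both ends. The control is then \<open>u = f - g\<close>.

  For uniqueness, \<open>f\<close> is determined successively on intervals of length \<open>2 l0\<close>, since reflection
  at the front decreases the argument by at least \<open>2 l0\<close>.
\<close>

section \<open>One-sided calculus on closed intervals: gluing, monotonicity, inverse functions, a
  Gronwall estimate\<close>

lemma deriv_on_eq:
  assumes "(f has_real_derivative d) (at x within {a..b})" and "a < b" and "x \<in> {a..b}"
  shows "deriv_on {a..b} f x = d"
  using assms
  by (intro vector_derivative_within_closed_interval)
     (auto simp: has_real_derivative_iff_has_vector_derivative)

lemma C1_on_deriv_on:
  assumes "C1_on {a..b} f" and "a < b"
  shows "\<And>x. x \<in> {a..b} \<Longrightarrow> (f has_real_derivative deriv_on {a..b} f x) (at x within {a..b})"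
    and "continuous_on {a..b} (deriv_on {a..b} f)"
proof -
  obtain f' where f': "\<forall>x\<in>{a..b}. (f has_real_derivative f' x) (at x within {a..b})"
    and cont: "continuous_on {a..b} f'"
    using assms(1) by (auto simp: C1_on_def)
  have eq: "deriv_on {a..b} f x = f' x" if "x \<in> {a..b}" for x
    using deriv_on_eq f' \<open>a < b\<close> that by blast
  show "\<And>x. x \<in> {a..b} \<Longrightarrow> (f has_real_derivative deriv_on {a..b} f x) (at x within {a..b})"
    using eq f' by simp
  show "continuous_on {a..b} (deriv_on {a..b} f)"
    using cont eq by (metis (no_types, lifting) continuous_on_cong)
qed

lemma C1_onI:
  assumes "\<And>x. x \<in> S \<Longrightarrow> (f has_real_derivative f' x) (at x within S)" and "continuous_on S f'"
  shows "C1_on S f"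
  using assms by (auto simp: C1_on_def)

text \<open>At a point outside a closed set the filter within that set is trivial and every
  derivative holds vacuously. Hence pieces on adjacent intervals can be glued by checking only those
  that contain \<open>x\<close>.\<close>

lemma has_real_derivative_within_Un:
  fixes f :: "real \<Rightarrow> real"
  assumes "closed S" and "closed T"
    and "x \<in> S \<Longrightarrow> (f has_real_derivative D) (at x within S)"
    and "x \<in> T \<Longrightarrow> (f has_real_derivative D) (at x within T)"
  shows "(f has_real_derivative D) (at x within S \<union> T)"
proof -
  have *: "(f has_real_derivative D) (at x within X)" if "closed X" "x \<notin> X" for X
  proof -
    have "at x within X = bot"
      using that by (simp add: closed_limpt trivial_limit_within) blast
    then show ?thesis by (simp add: has_field_derivative_iff)
  qed
  have "(f has_real_derivative D) (at x within S)" "(f has_real_derivative D) (at x within T)"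
    using * assms by blast+
  then show ?thesis
    by (simp add: has_field_derivative_iff Lim_within_Un)
qed

lemma has_real_derivative_chain_within:
  fixes f g :: "real \<Rightarrow> real"
  assumes "(f has_real_derivative D) (at (g x) within T)"
    and "(g has_real_derivative E) (at x within S)" and "\<And>x. x \<in> S \<Longrightarrow> g x \<in> T"
  shows "((\<lambda>x. f (g x)) has_real_derivative D * E) (at x within S)"
  using DERIV_image_chain[OF DERIV_subset[OF assms(1)] assms(2)] assms(3)
  by (auto simp: o_def)

lemma nonincreasing_within:
  fixes f :: "real \<Rightarrow> real"
  assumes "\<And>x. x \<in> {a..b} \<Longrightarrow> (f has_real_derivative f' x) (at x within {a..b})"
    and "\<And>x. x \<in> {a..b} \<Longrightarrow> f' x \<le> 0" and "a \<le> b"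
  shows "f b \<le> f a"
proof (rule DERIV_nonpos_imp_decreasing_open[OF \<open>a \<le> b\<close>])
  show "continuous_on {a..b} f"
    using assms(1) DERIV_continuous_on by blast
  fix x assume x: "a < x" "x < b"
  then have "at x within {a..b} = at x" by (simp add: at_within_Icc_at)
  then show "\<exists>y. DERIV f x :> y \<and> y \<le> 0"
    using assms(1)[of x] assms(2)[of x] x by auto
qed

lemma nondecreasing_within:
  fixes f :: "real \<Rightarrow> real"
  assumes "\<And>x. x \<in> {a..b} \<Longrightarrow> (f has_real_derivative f' x) (at x within {a..b})"
    and "\<And>x. x \<in> {a..b} \<Longrightarrow> f' x \<ge> 0" and "a \<le> b"
  shows "f a \<le> f b"
  using nonincreasing_within[of a b "\<lambda>x. - f x" "\<lambda>x. - f' x"] assms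
  by (simp add: DERIV_minus)

lemma equal_derivative_within:
  fixes f g :: "real \<Rightarrow> real"
  assumes "\<And>x. x \<in> {a..b} \<Longrightarrow> (f has_real_derivative f' x) (at x within {a..b})"
    and "\<And>x. x \<in> {a..b} \<Longrightarrow> (g has_real_derivative f' x) (at x within {a..b})"
    and "c \<in> {a..b}" "f c = g c" "x \<in> {a..b}"
  shows "f x = g x"
proof -
  have d: "((\<lambda>x. f x - g x) has_real_derivative 0) (at x within {a..b})" if "x \<in> {a..b}" for x
    using DERIV_diff[OF assms(1) assms(2)] that by fastforce
  have "f u - g u = f v - g v" if "u \<in> {a..b}" "v \<in> {a..b}" "u \<le> v" for u v
  proof -
    have d': "((\<lambda>x. f x - g x) has_real_derivative 0) (at x within {u..v})" if "x \<in> {u..v}" for x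
      using DERIV_subset[OF d, of x "{u..v}"] that \<open>u \<in> _\<close> \<open>v \<in> _\<close> by auto
    show ?thesis
      using nonincreasing_within[OF d' _ \<open>u \<le> v\<close>] nondecreasing_within[OF d' _ \<open>u \<le> v\<close>] by simp
  qed
  then show ?thesis
    using assms(3-5) by (metis diff_eq_diff_eq linear)
qed

lemma strict_mono_on_within:
  fixes \<phi> :: "real \<Rightarrow> real"
  assumes "\<And>x. x \<in> {a..b} \<Longrightarrow> (\<phi> has_real_derivative \<phi>' x) (at x within {a..b})"
    and "\<And>x. x \<in> {a..b} \<Longrightarrow> \<phi>' x > 0"
  shows "strict_mono_on {a..b} \<phi>"
proof (rule strict_mono_onI)
  fix u v assume uv: "u \<in> {a..b}" "v \<in> {a..b}" "u < v"
  show "\<phi> u < \<phi> v"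
  proof (rule DERIV_pos_imp_increasing_open[OF \<open>u < v\<close>])
    have "continuous_on {a..b} \<phi>"
      using assms(1) DERIV_continuous_on by blast
    then show "continuous_on {u..v} \<phi>"
      using uv continuous_on_subset by fastforce
    fix x assume x: "u < x" "x < v"
    then have "at x within {a..b} = at x" using uv by (intro at_within_Icc_at) auto
    then show "\<exists>y. DERIV \<phi> x :> y \<and> y > 0"
      using assms(1)[of x] assms(2)[of x] x uv by auto
  qed
qed

text \<open>Inverse function theorem including the endpoints. Compactness makes
  \<open>\<theta>\<close> continuous; since \<open>\<theta> y\<close> tends to
  \<open>\<theta> s\<close> without attaining it, the difference quotient of \<open>\<phi>\<close>
  can be composed with \<open>\<theta>\<close> and inverted.\<close>

lemma C1_inverse:
  fixes \<phi> \<phi>' :: "real \<Rightarrow> real"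
  assumes d: "\<And>x. x \<in> {a..b} \<Longrightarrow> (\<phi> has_real_derivative \<phi>' x) (at x within {a..b})"
    and pos: "\<And>x. x \<in> {a..b} \<Longrightarrow> \<phi>' x > 0" and "a \<le> b"
  defines "\<theta> \<equiv> the_inv_into {a..b} \<phi>"
  shows "\<And>t. t \<in> {a..b} \<Longrightarrow> \<theta> (\<phi> t) = t"
    and "\<And>t. t \<in> {a..b} \<Longrightarrow> \<phi> t \<in> {\<phi> a..\<phi> b}"
    and "\<And>s. s \<in> {\<phi> a..\<phi> b} \<Longrightarrow> \<theta> s \<in> {a..b}"
    and "\<And>s. s \<in> {\<phi> a..\<phi> b} \<Longrightarrow> \<phi> (\<theta> s) = s"
    and "continuous_on {\<phi> a..\<phi> b} \<theta>"
    and "\<And>s. s \<in> {\<phi> a..\<phi> b} \<Longrightarrow>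
      (\<theta> has_real_derivative 1 / \<phi>' (\<theta> s)) (at s within {\<phi> a..\<phi> b})"
proof -
  have sm: "strict_mono_on {a..b} \<phi>"
    using strict_mono_on_within d pos by blast
  then have inj: "inj_on \<phi> {a..b}"
    by (rule strict_mono_on_imp_inj_on)
  have cont: "continuous_on {a..b} \<phi>"
    using d DERIV_continuous_on by blast
  have image: "\<phi> ` {a..b} = {\<phi> a..\<phi> b}"
  proof
    show "\<phi> ` {a..b} \<subseteq> {\<phi> a..\<phi> b}"
      using strict_mono_on_leD[OF sm] by fastforce
    show "{\<phi> a..\<phi> b} \<subseteq> \<phi> ` {a..b}"
      using IVT'[of \<phi> a _ b] cont \<open>a \<le> b\<close> by fastforce
  qed
  show t1: "\<theta> (\<phi> t) = t" if "t \<in> {a..b}" for t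
    using the_inv_into_f_f[OF inj that] by (simp add: \<theta>_def)
  show "\<phi> t \<in> {\<phi> a..\<phi> b}" if "t \<in> {a..b}" for t
    using image that by blast
  show t2: "\<theta> s \<in> {a..b}" if "s \<in> {\<phi> a..\<phi> b}" for s
    using the_inv_into_into[OF inj, of s "{a..b}"] image that by (simp add: \<theta>_def)
  show t3: "\<phi> (\<theta> s) = s" if "s \<in> {\<phi> a..\<phi> b}" for s
    using f_the_inv_into_f[OF inj, of s] image that by (simp add: \<theta>_def)
  show t4: "continuous_on {\<phi> a..\<phi> b} \<theta>"
    using continuous_on_inv[OF cont compact_Icc] t1 image by fastforce
  show "(\<theta> has_real_derivative 1 / \<phi>' (\<theta> s)) (at s within {\<phi> a..\<phi> b})"
    if s: "s \<in> {\<phi> a..\<phi> b}" for s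
  proof -
    have ev: "\<forall>\<^sub>F y in at s within {\<phi> a..\<phi> b}. y \<in> {\<phi> a..\<phi> b} \<and> y \<noteq> s"
      by (auto simp: eventually_at_filter)
    have "filterlim \<theta> (at (\<theta> s) within {a..b}) (at s within {\<phi> a..\<phi> b})"
      unfolding filterlim_at
    proof
      show "\<forall>\<^sub>F y in at s within {\<phi> a..\<phi> b}. \<theta> y \<in> {a..b} \<and> \<theta> y \<noteq> \<theta> s"
        using ev by eventually_elim (metis s t2 t3)
      show "(\<theta> \<longlongrightarrow> \<theta> s) (at s within {\<phi> a..\<phi> b})"
        using t4 s by (simp add: continuous_on)
    qed
    from filterlim_compose[OF _ this] d[OF t2[OF s]]
    have "((\<lambda>y. (\<phi> (\<theta> y) - \<phi> (\<theta> s)) / (\<theta> y - \<theta> s)) \<longlongrightarrow> \<phi>' (\<theta> s)) (at s within {\<phi> a..\<phi> b})"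
      by (auto simp: has_field_derivative_iff)
    from tendsto_inverse[OF this] pos[OF t2[OF s]]
    have "((\<lambda>y. inverse ((\<phi> (\<theta> y) - \<phi> (\<theta> s)) / (\<theta> y - \<theta> s))) \<longlongrightarrow> 1 / \<phi>' (\<theta> s))
        (at s within {\<phi> a..\<phi> b})"
      by (auto simp: inverse_eq_divide)
    then show ?thesis
      unfolding has_field_derivative_iff
      by (rule Lim_transform_eventually) (use ev in \<open>eventually_elim, simp add: t3[OF s] t3\<close>)
  qed
qed

text \<open>Gronwall's argument: the bound makes the energy \<open>e\<close> nonincreasing, and
  \<open>e\<close> starts at 0 and is never negative.\<close>

lemma zero_of_derivative_bound:
  fixes h :: "real \<Rightarrow> real"
  assumes d: "\<And>x. x \<in> {a..b} \<Longrightarrow> (h has_real_derivative h' x) (at x within {a..b})"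
    and bound: "\<And>x. x \<in> {a..b} \<Longrightarrow> \<bar>h' x\<bar> \<le> C * \<bar>h x\<bar>"
    and "h a = 0" and x: "x \<in> {a..b}"
  shows "h x = 0"
proof -
  define e where "e s = (h s)\<^sup>2 * exp (- 2 * C * s)" for s
  have "e x \<le> e a"
  proof (rule nonincreasing_within[where f = e and
        f' = "\<lambda>s. (2 * (h s * h' s) - 2 * C * (h s)\<^sup>2) * exp (- 2 * C * s)"])
    fix s assume s: "s \<in> {a..x}"
    show "(e has_real_derivative (2 * (h s * h' s) - 2 * C * (h s)\<^sup>2) * exp (- 2 * C * s))
        (at s within {a..x})"
      unfolding e_def[abs_def] using s x
      by (auto intro!: derivative_eq_intros DERIV_subset[OF d] simp: algebra_simps power2_eq_square)
    have "h s * h' s \<le> \<bar>h s\<bar> * \<bar>h' s\<bar>"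
      by (metis abs_ge_self abs_mult)
    also have "\<dots> \<le> \<bar>h s\<bar> * (C * \<bar>h s\<bar>)"
      using bound s x by (intro mult_left_mono) auto
    also have "\<dots> = C * (h s)\<^sup>2"
      by (simp add: power2_eq_square)
    finally show "(2 * (h s * h' s) - 2 * C * (h s)\<^sup>2) * exp (- 2 * C * s) \<le> 0"
      by (simp add: mult_le_0_iff)
  qed (use x in auto)
  also have "e a = 0" using \<open>h a = 0\<close> by (simp add: e_def)
  finally have "(h x)\<^sup>2 \<le> 0"
    by (simp add: e_def mult_le_0_iff) 
  then show ?thesis by simp
qed

section \<open>The front speed law and locally Lipschitz toughness\<close>

lemma front_speed_bounds:
  assumes "0 < k" and "0 \<le> q"
  shows "0 \<le> front_speed q k" and "front_speed q k < 1"
  using assms by (auto simp: front_speed_def)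

text \<open>For a speed \<open>V\<close>, the quotient \<open>V / (1 - V)\<close> is the rate of the
  front length in the variable \<open>s = t - L t\<close>. In this form the toughness enters only
  through \<open>q / k\<close>, which is Lipschitz in \<open>k\<close> away from 0.\<close>

lemma front_speed_ratio:
  assumes "0 < k" and "0 \<le> q"
  shows "front_speed q k / (1 - front_speed q k) = max (q / (2 * k) - 1/2) 0"
proof (cases "q \<le> k")
  case True
  then show ?thesis using assms
    by (auto simp: front_speed_def max_def field_simps)
next
  case False
  then have "front_speed q k = (q - k) / (q + k)"
    using assms by (simp add: front_speed_def)
  moreover have "1 - (q - k) / (q + k) = 2 * k / (q + k)"
    using assms by (simp add: field_simps)
  ultimately have "front_speed q k / (1 - front_speed q k) = ((q - k) / (q + k)) / (2 * k / (q + k))"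
    by presburger
  also have "\<dots> = (q - k) / (2 * k)"
    using assms by simp
  also have "\<dots> = q / (2 * k) - 1/2"
    using assms by (simp add: field_simps)
  finally show ?thesis
    using assms False by (simp add: max_def field_simps)
qed

lemma continuous_on_locally_Lipschitz:
  assumes "locally_Lipschitz_on {0..} \<kappa>" shows "continuous_on {0..} \<kappa>"
proof -
  have "local_lipschitz {0::real} {0..} (\<lambda>_. \<kappa>)"
    using assms unfolding local_lipschitz_def locally_Lipschitz_on_def by blast
  then show ?thesis
    by (rule local_lipschitz_continuous_on) auto
qed

lemma locally_Lipschitz_compact:
  assumes "locally_Lipschitz_on {0..} \<kappa>"
  obtains C where "C \<ge> 0" "\<And>x y. x \<in> {0..M} \<Longrightarrow> y \<in> {0..M} \<Longrightarrow> \<bar>\<kappa> x - \<kappa> y\<bar> \<le> C * \<bar>x - y\<bar>"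
proof -
  \<comment> \<open>The one-point time set \<open>{0}\<close> casts the toughness as a
    time-dependent family, to which compactness of space and time applies.\<close>
  have "local_lipschitz {0::real} {0..M} (\<lambda>_. \<kappa>)"
    unfolding local_lipschitz_def
  proof (intro ballI)
    fix x t :: real assume "x \<in> {0..M}"
    then obtain \<epsilon> C where "\<epsilon> > 0" "C-lipschitz_on (cball x \<epsilon> \<inter> {0..}) \<kappa>"
      using assms by (force simp: locally_Lipschitz_on_def)
    then show "\<exists>u>0. \<exists>L. \<forall>t\<in>cball t u \<inter> {0}. L-lipschitz_on (cball x u \<inter> {0..M}) \<kappa>"
      using lipschitz_on_subset[of C "cball x \<epsilon> \<inter> {0..}" \<kappa> "cball x \<epsilon> \<inter> {0..M}"] Int_iff
      by (force intro: exI[of _ \<epsilon>])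
  qed
  from local_lipschitz_compact_implies_lipschitz[OF this]
  obtain C where "C-lipschitz_on {0..M} \<kappa>" by auto
  then show ?thesis
    by (intro that[of C]) (auto simp: lipschitz_on_def dist_real_def)
qed

section \<open>Kinematics of a front and of the characteristics that meet it\<close>

text \<open>Speed in \<open>[0, 1)\<close> makes both \<open>t - L t\<close> and
  \<open>t + L t\<close> strictly increasing with positive derivative. No force law is imposed, so
  the locale serves the initial branch as well as the complete front.\<close>

locale moving_front =
  fixes T l0 :: real and L V :: "real \<Rightarrow> real"
  assumes T_pos: "0 < T" and l0_pos: "0 < l0"
    and L_deriv: "\<And>t. t \<in> {0..T} \<Longrightarrow> (L has_real_derivative V t) (at t within {0..T})"
    and V_cont: "continuous_on {0..T} V"
    and L_0: "L 0 = l0"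
    and V_bounds: "\<And>t. t \<in> {0..T} \<Longrightarrow> 0 \<le> V t" "\<And>t. t \<in> {0..T} \<Longrightarrow> V t < 1"
begin

lemma L_mono:
  assumes "0 \<le> s" "s \<le> t" "t \<le> T"
  shows "L s \<le> L t"
  by (rule nondecreasing_within[where f = L and f' = V])
     (use assms V_bounds in \<open>auto intro: DERIV_subset[OF L_deriv]\<close>)

lemma L_ge: "t \<in> {0..T} \<Longrightarrow> l0 \<le> L t"
  using L_mono[of 0 t] L_0 by simp

lemma L_pos: "t \<in> {0..T} \<Longrightarrow> 0 < L t"
  using L_ge[of t] l0_pos by simp

text \<open>The inverse of \<open>\<tau>\<^sub>-\<close>: the time at which the outgoing
  characteristic \<open>t - x = s\<close> reaches the front.\<close>

definition tau_inv :: "real \<Rightarrow> real" where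
  "tau_inv = the_inv_into {0..T} (\<lambda>t. t - L t)"

definition tau_plus_inv :: "real \<Rightarrow> real" where
  "tau_plus_inv = the_inv_into {0..T} (\<lambda>t. t + L t)"

lemma tau_deriv:
  assumes "t \<in> {0..T}"
  shows "((\<lambda>t. t - L t) has_real_derivative 1 - V t) (at t within {0..T})"
    and "((\<lambda>t. t + L t) has_real_derivative 1 + V t) (at t within {0..T})"
  using assms by (auto intro!: derivative_eq_intros L_deriv)

lemma tau_inv:
  shows "\<And>t. t \<in> {0..T} \<Longrightarrow> tau_inv (t - L t) = t"
    and "\<And>t. t \<in> {0..T} \<Longrightarrow> t - L t \<in> {-l0..T - L T}"
    and "\<And>s. s \<in> {-l0..T - L T} \<Longrightarrow> tau_inv s \<in> {0..T}"
    and "\<And>s. s \<in> {-l0..T - L T} \<Longrightarrow> tau_inv s - L (tau_inv s) = s"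
    and "continuous_on {-l0..T - L T} tau_inv"
    and "\<And>s. s \<in> {-l0..T - L T} \<Longrightarrow>
      (tau_inv has_real_derivative 1 / (1 - V (tau_inv s))) (at s within {-l0..T - L T})"
  using C1_inverse[where a = 0 and b = T and \<phi> = "\<lambda>t. t - L t" and \<phi>' = "\<lambda>t. 1 - V t"]
    tau_deriv(1) V_bounds(2) T_pos L_0
  by (auto simp: tau_inv_def)

lemma tau_plus_inv:
  shows "\<And>t. t \<in> {0..T} \<Longrightarrow> tau_plus_inv (t + L t) = t"
    and "\<And>t. t \<in> {0..T} \<Longrightarrow> t + L t \<in> {l0..T + L T}"
    and "\<And>s. s \<in> {l0..T + L T} \<Longrightarrow> tau_plus_inv s \<in> {0..T}"
    and "\<And>s. s \<in> {l0..T + L T} \<Longrightarrow> tau_plus_inv s + L (tau_plus_inv s) = s"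
    and "continuous_on {l0..T + L T} tau_plus_inv"
    and "\<And>s. s \<in> {l0..T + L T} \<Longrightarrow>
      (tau_plus_inv has_real_derivative 1 / (1 + V (tau_plus_inv s))) (at s within {l0..T + L T})"
proof -
  have "0 < 1 + V t" if "t \<in> {0..T}" for t
    using V_bounds(1)[OF that] by simp
  note * = C1_inverse[where a = 0 and b = T and \<phi> = "\<lambda>t. t + L t" and \<phi>' = "\<lambda>t. 1 + V t",
      OF tau_deriv(2) this, simplified L_0 add_0]
  show "\<And>t. t \<in> {0..T} \<Longrightarrow> tau_plus_inv (t + L t) = t"
    and "\<And>t. t \<in> {0..T} \<Longrightarrow> t + L t \<in> {l0..T + L T}"
    and "\<And>s. s \<in> {l0..T + L T} \<Longrightarrow> tau_plus_inv s \<in> {0..T}"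
    and "\<And>s. s \<in> {l0..T + L T} \<Longrightarrow> tau_plus_inv s + L (tau_plus_inv s) = s"
    and "continuous_on {l0..T + L T} tau_plus_inv"
    and "\<And>s. s \<in> {l0..T + L T} \<Longrightarrow>
      (tau_plus_inv has_real_derivative 1 / (1 + V (tau_plus_inv s))) (at s within {l0..T + L T})"
    using * T_pos unfolding tau_plus_inv_def by auto
qed

lemma reflect_eq: "reflect T L s = tau_plus_inv s - L (tau_plus_inv s)"
  by (simp add: reflect_def tau_plus_inv_def Let_def)

lemma reflect_tau: "t \<in> {0..T} \<Longrightarrow> reflect T L (t + L t) = t - L t"
  by (simp add: reflect_eq tau_plus_inv(1))

text \<open>If \<open>t\<close> is the time of reflection, then \<open>t - L t = s - 2 * L t\<close>
  with \<open>L t\<close> at least \<open>l0\<close>. This gain of \<open>2 * l0\<close> drives the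
  induction for uniqueness.\<close>

lemma reflect_bounds:
  assumes "s \<in> {l0..T + L T}"
  shows "reflect T L s \<in> {-l0..T - L T}" and "reflect T L s \<le> s - 2 * l0"
  using tau_plus_inv(3,4)[OF assms] tau_inv(2) L_ge[of "tau_plus_inv s"]
  by (auto simp: reflect_eq)

text \<open>The derivative is the Doppler factor of the moving front, the quotient of the
  derivatives of \<open>\<tau>\<^sub>-\<close> and \<open>\<tau>\<^sub>+\<close>.\<close>

lemma reflect_deriv:
  assumes "s \<in> {l0..T + L T}"
  shows "(reflect T L has_real_derivative
    (1 - V (tau_plus_inv s)) / (1 + V (tau_plus_inv s))) (at s within {l0..T + L T})"
proof -
  have *: "((\<lambda>s. (\<lambda>t. t - L t) (tau_plus_inv s)) has_real_derivative
      (1 - V (tau_plus_inv s)) * (1 / (1 + V (tau_plus_inv s)))) (at s within {l0..T + L T})"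
    by (rule has_real_derivative_chain_within[OF tau_deriv(1) tau_plus_inv(6)[OF assms]])
       (use tau_plus_inv(3) assms in auto)
  then show ?thesis by (simp add: reflect_eq[abs_def])
qed

end

section \<open>Uniqueness of the front and of the displacement\<close>

text \<open>\<open>F t\<close> stands for \<open>f'(t - L t)\<close>. As a function of time it lets
  two fronts be compared even when a common dependence on \<open>t - L t\<close> is known only up to
  some level.\<close>

locale griffith_front = moving_front T l0 L V for T l0 L V +
  fixes \<kappa> :: "real \<Rightarrow> real" and c1 :: real and F :: "real \<Rightarrow> real"
  assumes c1_pos: "0 < c1" and \<kappa>_ge: "\<And>x. 0 \<le> x \<Longrightarrow> c1 \<le> \<kappa> x"
    and V_eq: "\<And>t. t \<in> {0..T} \<Longrightarrow> V t = front_speed (2 * (F t)\<^sup>2) (\<kappa> (L t))"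
begin

lemma \<kappa>_pos: "t \<in> {0..T} \<Longrightarrow> 0 < \<kappa> (L t)"
  using \<kappa>_ge[of "L t"] L_pos[of t] c1_pos by auto

text \<open>
  As a function of \<open>t\<close> the front solves an equation whose right-hand side is merely continuous
  in \<open>t - L t\<close>; as a function of \<open>s = t - L t\<close> it solves one that is Lipschitz in the unknown.
\<close>

lemma L_tau_inv_deriv:
  assumes "s \<in> {-l0..T - L T}"
  shows "((\<lambda>s. L (tau_inv s)) has_real_derivative
     max (2 * (F (tau_inv s))\<^sup>2 / (2 * \<kappa> (L (tau_inv s))) - 1/2) 0) (at s within {-l0..T - L T})"
proof -
  let ?t = "tau_inv s"
  have t: "?t \<in> {0..T}" using tau_inv(3)[OF assms] .
  have "((\<lambda>s. L (tau_inv s)) has_real_derivative V ?t * (1 / (1 - V ?t)))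
      (at s within {-l0..T - L T})"
    by (rule has_real_derivative_chain_within[OF L_deriv tau_inv(6)[OF assms]])
       (use t tau_inv(3) in auto)
  moreover have "V ?t * (1 / (1 - V ?t)) = max (2 * (F ?t)\<^sup>2 / (2 * \<kappa> (L ?t)) - 1/2) 0"
    using front_speed_ratio[OF \<kappa>_pos[OF t], of "2 * (F ?t)\<^sup>2"] V_eq[OF t] by simp
  ultimately show ?thesis by simp
qed

end

text \<open>In the variable \<open>s = t - L t\<close> both fronts solve the same scalar equation up
  to \<open>\<sigma>\<close>, so Gronwall's argument identifies them. The last bound on
  \<open>t\<close> puts \<open>\<sigma>\<close> in the range of \<open>\<tau>\<^sub>-\<close> for
  the second front too; equal lengths at \<open>\<sigma>\<close> then mean equal times, as the time
  is \<open>\<sigma>\<close> plus the length.\<close>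

lemma front_agree:
  assumes 1: "griffith_front T l0 L1 V1 \<kappa> c1 F1" and 2: "griffith_front T l0 L2 V2 \<kappa> c1 F2"
    and lip: "locally_Lipschitz_on {0..} \<kappa>"
    and p: "continuous_on {-l0..r} p"
    and F1: "\<And>t. t \<in> {0..T} \<Longrightarrow> t - L1 t \<le> r \<Longrightarrow> F1 t = p (t - L1 t)"
    and F2: "\<And>t. t \<in> {0..T} \<Longrightarrow> t - L2 t \<le> r \<Longrightarrow> F2 t = p (t - L2 t)"
    and t: "t \<in> {0..T}" "t - L1 t \<le> r" "t - L1 t \<le> T - L2 T"
  shows "L2 t = L1 t"
proof -
  interpret f1: griffith_front T l0 L1 V1 \<kappa> c1 F1 by (fact 1)
  interpret f2: griffith_front T l0 L2 V2 \<kappa> c1 F2 by (fact 2)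
  define \<sigma> where "\<sigma> = t - L1 t"
  have \<sigma>: "-l0 \<le> \<sigma>" "\<sigma> \<le> T - L1 T" "\<sigma> \<le> T - L2 T" "\<sigma> \<le> r"
    using f1.tau_inv(2)[OF t(1)] t by (auto simp: \<sigma>_def)
  define \<Lambda>1 where "\<Lambda>1 s = L1 (f1.tau_inv s)" for s
  define \<Lambda>2 where "\<Lambda>2 s = L2 (f2.tau_inv s)" for s
  define G where "G s x = max (2 * (p s)\<^sup>2 / (2 * \<kappa> x) - 1/2) 0" for s x
  have d1: "(\<Lambda>1 has_real_derivative G s (\<Lambda>1 s)) (at s within {-l0..\<sigma>})" if "s \<in> {-l0..\<sigma>}" for s
  proof -
    have "F1 (f1.tau_inv s) = p s"
      using F1[of "f1.tau_inv s"] f1.tau_inv(3,4)[of s] that \<sigma> by auto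
    then show ?thesis
      using f1.L_tau_inv_deriv[of s] that \<sigma> unfolding \<Lambda>1_def[abs_def] G_def
      by (auto intro: DERIV_subset)
  qed
  have d2: "(\<Lambda>2 has_real_derivative G s (\<Lambda>2 s)) (at s within {-l0..\<sigma>})" if "s \<in> {-l0..\<sigma>}" for s
  proof -
    have "F2 (f2.tau_inv s) = p s"
      using F2[of "f2.tau_inv s"] f2.tau_inv(3,4)[of s] that \<sigma> by auto
    then show ?thesis
      using f2.L_tau_inv_deriv[of s] that \<sigma> unfolding \<Lambda>2_def[abs_def] G_def
      by (auto intro: DERIV_subset)
  qed
  have "continuous_on {-l0..\<sigma>} (\<lambda>s. (p s)\<^sup>2)"
    using p \<sigma> by (auto intro!: continuous_intros intro: continuous_on_subset)
  then obtain s0 where "s0 \<in> {-l0..\<sigma>}" "\<forall>s\<in>{-l0..\<sigma>}. (p s)\<^sup>2 \<le> (p s0)\<^sup>2"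
    using continuous_attains_sup[of "{-l0..\<sigma>}"] \<sigma> by fastforce
  then obtain Q where Q: "0 \<le> Q" "\<And>s. s \<in> {-l0..\<sigma>} \<Longrightarrow> (p s)\<^sup>2 \<le> Q"
    by (meson zero_le_power2)
  define M where "M = max (L1 T) (L2 T)"
  have \<Lambda>1: "\<Lambda>1 s \<in> {0..M}" if "s \<in> {-l0..\<sigma>}" for s
    using f1.tau_inv(3)[of s] f1.L_mono[of "f1.tau_inv s" T] f1.L_pos[of "f1.tau_inv s"] that \<sigma>
    by (auto simp: \<Lambda>1_def M_def)
  have \<Lambda>2: "\<Lambda>2 s \<in> {0..M}" if "s \<in> {-l0..\<sigma>}" for s
    using f2.tau_inv(3)[of s] f2.L_mono[of "f2.tau_inv s" T] f2.L_pos[of "f2.tau_inv s"] that \<sigma>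
    by (auto simp: \<Lambda>2_def M_def)
  obtain C where C: "C \<ge> 0"
    "\<And>x y. x \<in> {0..M} \<Longrightarrow> y \<in> {0..M} \<Longrightarrow> \<bar>\<kappa> x - \<kappa> y\<bar> \<le> C * \<bar>x - y\<bar>"
    using locally_Lipschitz_compact[OF lip] by blast
  \<comment> \<open>Taking the maximum with 0 does not increase distances, so only
    \<open>1 / \<kappa>\<close> matters: \<open>Q\<close> bounds the square of \<open>p\<close>,
    \<open>C\<close> is the Lipschitz constant of \<open>\<kappa>\<close>, and \<open>c1\<close>
    bounds \<open>\<kappa>\<close> from below.\<close>
  have G_lip: "\<bar>G s x - G s y\<bar> \<le> (Q * C / c1\<^sup>2) * \<bar>x - y\<bar>"
    if s: "s \<in> {-l0..\<sigma>}" and x: "x \<in> {0..M}" and y: "y \<in> {0..M}" for s x y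
  proof -
    have k: "c1 \<le> \<kappa> x" "c1 \<le> \<kappa> y" "0 < c1"
      using x y f1.\<kappa>_ge f1.c1_pos by auto
    have "G s z = max ((p s)\<^sup>2 / \<kappa> z - 1/2) 0" for z
      by (simp add: G_def)
    from this[of x] this[of y]
    have "\<bar>G s x - G s y\<bar> \<le> \<bar>(p s)\<^sup>2 / \<kappa> x - (p s)\<^sup>2 / \<kappa> y\<bar>"
      by linarith
    also have "\<dots> = (p s)\<^sup>2 * \<bar>\<kappa> x - \<kappa> y\<bar> / (\<kappa> x * \<kappa> y)"
    proof -
      have "(p s)\<^sup>2 / \<kappa> x - (p s)\<^sup>2 / \<kappa> y = (p s)\<^sup>2 * (\<kappa> y - \<kappa> x) / (\<kappa> x * \<kappa> y)"
        using k by (simp add: field_simps)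
      then show ?thesis
        using k by (simp add: abs_mult abs_minus_commute)
    qed
    also have "\<dots> \<le> Q * (C * \<bar>x - y\<bar>) / (c1 * c1)"
      using Q s C x y k by (intro frac_le mult_mono) auto
    finally show ?thesis by (simp add: power2_eq_square mult_ac)
  qed
  have zero: "\<Lambda>1 (-l0) - \<Lambda>2 (-l0) = 0"
    using f1.tau_inv(1)[of 0] f2.tau_inv(1)[of 0] f1.L_0 f2.L_0 f1.T_pos
    by (simp add: \<Lambda>1_def \<Lambda>2_def)
  have "\<Lambda>1 \<sigma> - \<Lambda>2 \<sigma> = 0"
    by (rule zero_of_derivative_bound[where a = "-l0" and b = \<sigma> and h = "\<lambda>s. \<Lambda>1 s - \<Lambda>2 s"
          and h' = "\<lambda>s. G s (\<Lambda>1 s) - G s (\<Lambda>2 s)" and C = "Q * C / c1\<^sup>2"])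
       (use zero G_lip \<Lambda>1 \<Lambda>2 \<sigma> d1 d2 in \<open>auto intro!: DERIV_diff\<close>)
  then have "\<Lambda>2 \<sigma> = L1 t"
    using f1.tau_inv(1)[OF t(1)] by (simp add: \<Lambda>1_def \<sigma>_def)
  moreover from this have "f2.tau_inv \<sigma> = t"
    using f2.tau_inv(4)[of \<sigma>] \<sigma> by (simp add: \<Lambda>2_def \<sigma>_def)
  ultimately show ?thesis by (simp add: \<Lambda>2_def)
qed

text \<open>Knowing \<open>f'\<close> up to \<open>r\<close> fixes reflection up to
  \<open>r + 2 * l0\<close>, because a reflected argument is smaller by at least
  \<open>2 * l0\<close>.\<close>

lemma reflect_agree:
  assumes 1: "griffith_front T l0 L1 V1 \<kappa> c1 F1" and 2: "griffith_front T l0 L2 V2 \<kappa> c1 F2"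
    and lip: "locally_Lipschitz_on {0..} \<kappa>"
    and p: "continuous_on {-l0..r} p"
    and F1: "\<And>t. t \<in> {0..T} \<Longrightarrow> t - L1 t \<le> r \<Longrightarrow> F1 t = p (t - L1 t)"
    and F2: "\<And>t. t \<in> {0..T} \<Longrightarrow> t - L2 t \<le> r \<Longrightarrow> F2 t = p (t - L2 t)"
    and s: "s \<in> {l0..T}" "s \<le> r + 2 * l0"
  shows "reflect T L1 s = reflect T L2 s"
proof -
  \<comment> \<open>The fronts are ordered so that the smaller reflected argument comes first; it
    then lies below \<open>T - L2 T\<close>, as \<open>front_agree\<close> demands. The claim is
    symmetric, so this loses nothing.\<close>
  have key: "reflect T L1 s = reflect T L2 s"
    if 1: "griffith_front T l0 L1 V1 \<kappa> c1 F1" and 2: "griffith_front T l0 L2 V2 \<kappa> c1 F2"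
      and F1: "\<And>t. t \<in> {0..T} \<Longrightarrow> t - L1 t \<le> r \<Longrightarrow> F1 t = p (t - L1 t)"
      and F2: "\<And>t. t \<in> {0..T} \<Longrightarrow> t - L2 t \<le> r \<Longrightarrow> F2 t = p (t - L2 t)"
      and le: "reflect T L1 s \<le> reflect T L2 s" for L1 V1 F1 L2 V2 F2
  proof -
    interpret f1: griffith_front T l0 L1 V1 \<kappa> c1 F1 by (fact 1)
    interpret f2: griffith_front T l0 L2 V2 \<kappa> c1 F2 by (fact 2)
    have s1: "s \<in> {l0..T + L1 T}" and s2: "s \<in> {l0..T + L2 T}"
      using s f1.L_pos[of T] f2.L_pos[of T] f1.T_pos by auto
    let ?t = "f1.tau_plus_inv s"
    have t: "?t \<in> {0..T}" "?t + L1 ?t = s" "?t - L1 ?t = reflect T L1 s"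
      using f1.tau_plus_inv(3,4)[OF s1] by (auto simp: f1.reflect_eq)
    have "L2 ?t = L1 ?t"
      by (rule front_agree[OF 1 2 lip p F1 F2 t(1)])
         (use t f1.reflect_bounds[OF s1] f2.reflect_bounds[OF s2] le s in auto)
    then show ?thesis
      using f2.reflect_tau[OF t(1)] t by simp
  qed
  show ?thesis
    using key[OF 1 2 F1 F2] key[OF 2 1 F2 F1] by (metis linear)
qed

lemma solution_unique:
  assumes 1: "griffith_front T l0 L1 V1 \<kappa> c1 (\<lambda>t. p1 (t - L1 t))"
    and 2: "griffith_front T l0 L2 V2 \<kappa> c1 (\<lambda>t. p2 (t - L2 t))"
    and lip: "locally_Lipschitz_on {0..} \<kappa>"
    and d1: "\<And>s. s \<in> {-l0..T} \<Longrightarrow> (f1 has_real_derivative p1 s) (at s within {-l0..T})"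
    and d2: "\<And>s. s \<in> {-l0..T} \<Longrightarrow> (f2 has_real_derivative p2 s) (at s within {-l0..T})"
    and p1: "continuous_on {-l0..T} p1"
    and e1: "wave_f_eqs T l0 y0 y1 u L1 f1" and e2: "wave_f_eqs T l0 y0 y1 u L2 f2"
  shows "s \<in> {-l0..T} \<Longrightarrow> f1 s = f2 s" and "t \<in> {0..T} \<Longrightarrow> L1 t = L2 t"
proof -
  interpret f1: griffith_front T l0 L1 V1 \<kappa> c1 "\<lambda>t. p1 (t - L1 t)" by (fact 1)
  interpret f2: griffith_front T l0 L2 V2 \<kappa> c1 "\<lambda>t. p2 (t - L2 t)" by (fact 2)
  have T: "0 < T" and l0: "0 < l0" using f1.T_pos f1.l0_pos by auto
  \<comment> \<open>Comparing derivatives within \<open>{-l0..r}\<close> gives equality at the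
    endpoint \<open>r\<close> as well, without information beyond it.\<close>
  have p_eq: "p1 s = p2 s" if "\<And>s. s \<in> {-l0..r} \<Longrightarrow> f1 s = f2 s" "-l0 < r" "r \<le> T" "s \<in> {-l0..r}"
    for r s
  proof -
    have "(f1 has_real_derivative p1 s) (at s within {-l0..r})"
      and "(f2 has_real_derivative p2 s) (at s within {-l0..r})"
      using that by (auto intro: DERIV_subset[OF d1] DERIV_subset[OF d2])
    moreover from this(2) have "(f1 has_real_derivative p2 s) (at s within {-l0..r})"
      by (rule has_field_derivative_transform_within[where d = 1]) (use that in auto)
    ultimately show ?thesis
      using deriv_on_eq[of f1 _ s "-l0" r] that by metis
  qed
  \<comment> \<open>For \<open>n = 0\<close> the two equations for \<open>f\<close> that do not
    mention the front suffice. Each further round first identifies the reflections and then uses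
    \<open>f s = u s + f (reflect T L s)\<close>.\<close>
  have f_eq: "\<forall>s\<in>{-l0..T}. s \<le> l0 + real n * (2 * l0) \<longrightarrow> f1 s = f2 s" for n
  proof (induction n)
    case 0
    show ?case
    proof (intro ballI impI)
      fix s assume s: "s \<in> {-l0..T}" "s \<le> l0 + real 0 * (2 * l0)"
      show "f1 s = f2 s"
      proof (cases "s \<le> 0")
        case True
        then have "f s = 1/2 * integral {0..-s} (\<lambda>\<sigma>. deriv_on {0..l0} y0 \<sigma> - y1 \<sigma>)"
          if "wave_f_eqs T l0 y0 y1 u L f" for L f
          using that s unfolding wave_f_eqs_def by (metis atLeastAtMost_iff)
        then show ?thesis using e1 e2 by metis
      qed (use e1 e2 s in \<open>auto simp: wave_f_eqs_def\<close>)
    qed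
  next
    case (Suc n)
    define r where "r = min T (l0 + real n * (2 * l0))"
    have r: "-l0 < r" "r \<le> T"
      using T l0 by (auto simp: r_def add_pos_nonneg intro: less_le_trans[of _ 0])
    have eq: "f1 s = f2 s" if "s \<in> {-l0..r}" for s
      using Suc that r by (auto simp: r_def)
    show ?case
    proof (intro ballI impI)
      fix s assume s: "s \<in> {-l0..T}" "s \<le> l0 + real (Suc n) * (2 * l0)"
      show "f1 s = f2 s"
      proof (cases "s \<le> r")
        case True
        then show ?thesis using eq s by auto
      next
        case False
        \<comment> \<open>As \<open>s \<le> T\<close>, failure of \<open>s \<le> r\<close> excludes
          \<open>r = T\<close>; so \<open>s\<close> lies beyond \<open>l0\<close>, where the
          reflection equation governs.\<close>
        have "l0 + real n * (2 * l0) < s"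
          using False s by (auto simp: r_def)
        moreover have "0 \<le> real n * (2 * l0)"
          using l0 by simp
        ultimately have sl: "l0 < s"
          by linarith
        have "reflect T L1 s = reflect T L2 s"
        proof (rule reflect_agree[OF 1 2 lip, where r = r and p = p1])
          show "continuous_on {-l0..r} p1"
            using p1 r by (auto intro: continuous_on_subset)
          show "p2 (t - L2 t) = p1 (t - L2 t)" if "t \<in> {0..T}" "t - L2 t \<le> r" for t
            using p_eq[OF eq r, of "t - L2 t"] f2.tau_inv(2)[OF that(1)] that(2) by auto
          show "s \<le> r + 2 * l0"
            using s l0 by (auto simp: r_def min_def algebra_simps)
        qed (use s sl in auto)
        moreover have "reflect T L1 s \<in> {-l0..r}"
          using f1.reflect_bounds[of s] s sl f1.L_pos[of T] T l0
          by (auto simp: r_def algebra_simps)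
        ultimately show ?thesis
          using e1 e2 s sl eq unfolding wave_f_eqs_def by auto
      qed
    qed
  qed
  show f: "f1 s = f2 s" if "s \<in> {-l0..T}" for s
  proof -
    obtain n where "(s - l0) / (2 * l0) \<le> real n" using real_arch_simple by blast
    then have "s \<le> l0 + real n * (2 * l0)" using l0 by (simp add: field_simps)
    then show ?thesis using f_eq that by blast
  qed
  have p: "p1 s = p2 s" if "s \<in> {-l0..T}" for s
    by (rule p_eq[where r = T]) (use f that T l0 in auto)
  have range: "t - L1 t \<in> {-l0..T}" "t - L2 t \<in> {-l0..T}" if "t \<in> {0..T}" for t
    using f1.tau_inv(2)[OF that] f2.tau_inv(2)[OF that] f1.L_pos[OF that] f2.L_pos[OF that] that by auto
  \<comment> \<open>One of the two comparisons always applies: whichever front has the smaller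
    \<open>\<tau>\<^sub>-\<close> at time \<open>T\<close> keeps its arguments within the range of
    the other.\<close>
  have a: "L2 t = L1 t" if "t \<in> {0..T}" "t - L1 t \<le> T - L2 T" for t
    by (rule front_agree[OF 1 2 lip p1]) (use p range that in auto)
  have b: "L1 t = L2 t" if "t \<in> {0..T}" "t - L2 t \<le> T - L1 T" for t
    by (rule front_agree[OF 2 1 lip p1]) (use p range that in auto)
  show "L1 t = L2 t" if t: "t \<in> {0..T}"
    using a[OF t] b[OF t] f1.tau_inv(2)[OF t] f2.tau_inv(2)[OF t]
    by (metis atLeastAtMost_iff linear order_trans)
qed

text \<open>Griffith's law with positive toughness forces the speed of an arbitrary solution into
  \<open>[0, 1)\<close>, which makes the results on fronts applicable to it.\<close>

lemma C1_debonding_solution_front: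
  assumes sol: "C1_debonding_solution \<kappa> T l0 y0 y1 u L y"
    and "0 < T" and "0 < l0" and "0 < c1" and "\<And>x. 0 \<le> x \<Longrightarrow> c1 \<le> \<kappa> x"
  obtains f where "C1_on {-l0..T} f" and "wave_f_eqs T l0 y0 y1 u L f"
    and "\<And>t x. (t, x) \<in> debonding_domain T L
      \<Longrightarrow> y t x = f (t - x) - wave_g T l0 y0 y1 u L f (t + x)"
    and "griffith_front T l0 L (deriv_on {0..T} L) \<kappa> c1 (\<lambda>t. deriv_on {-l0..T} f (t - L t))"
proof -
  from sol obtain f where f: "C1_on {-l0..T} f" "wave_f_eqs T l0 y0 y1 u L f" "L 0 = l0"
      "\<forall>t\<in>{0..T}. deriv_on {0..T} L t
            = front_speed (2 * (deriv_on {-l0..T} f (t - L t))\<^sup>2) (\<kappa> (L t))"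
      "\<forall>(t, x)\<in>debonding_domain T L. y t x = f (t - x) - wave_g T l0 y0 y1 u L f (t + x)"
    and L: "\<forall>t\<in>{0..T}. 0 < L t" "C1_on {0..T} L"
    unfolding C1_debonding_solution_def by blast
  show ?thesis
  proof (rule that[OF f(1,2)])
    show "griffith_front T l0 L (deriv_on {0..T} L) \<kappa> c1 (\<lambda>t. deriv_on {-l0..T} f (t - L t))"
    proof unfold_locales
      fix t assume t: "t \<in> {0..T}"
      then have "0 < \<kappa> (L t)"
        using assms(4,5) L(1) by (meson less_eq_real_def less_le_trans)
      then show "0 \<le> deriv_on {0..T} L t" "deriv_on {0..T} L t < 1"
        using f(4) t front_speed_bounds by auto
    qed (use assms f L C1_on_deriv_on[OF L(2)] in auto)
  qed (use f in auto)
qed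

text \<open>The target must be reached by every solution for the control, so properties of the
  constructed solution have to be transferred. Agreement of \<open>f\<close> and of the fronts
  carries over to the reflections, hence to \<open>wave_g\<close> and to the displacement.\<close>

lemma C1_debonding_solution_unique:
  assumes sol1: "C1_debonding_solution \<kappa> T l0 y0 y1 u L1 z1"
    and sol2: "C1_debonding_solution \<kappa> T l0 y0 y1 u L2 z2"
    and pos: "0 < T" "0 < l0" "0 < c1" and \<kappa>: "\<And>x. 0 \<le> x \<Longrightarrow> c1 \<le> \<kappa> x"
    and lip: "locally_Lipschitz_on {0..} \<kappa>"
  shows "\<And>t. t \<in> {0..T} \<Longrightarrow> L1 t = L2 t"
    and "debonding_domain T L1 = debonding_domain T L2"
    and "\<And>t x. (t, x) \<in> debonding_domain T L1 \<Longrightarrow> z1 t x = z2 t x"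
proof -
  obtain f1 where f1: "C1_on {-l0..T} f1" "wave_f_eqs T l0 y0 y1 u L1 f1"
    "\<And>t x. (t, x) \<in> debonding_domain T L1
      \<Longrightarrow> z1 t x = f1 (t - x) - wave_g T l0 y0 y1 u L1 f1 (t + x)"
    "griffith_front T l0 L1 (deriv_on {0..T} L1) \<kappa> c1 (\<lambda>t. deriv_on {-l0..T} f1 (t - L1 t))"
    using C1_debonding_solution_front[OF sol1 pos \<kappa>] by blast
  obtain f2 where f2: "C1_on {-l0..T} f2" "wave_f_eqs T l0 y0 y1 u L2 f2"
    "\<And>t x. (t, x) \<in> debonding_domain T L2
      \<Longrightarrow> z2 t x = f2 (t - x) - wave_g T l0 y0 y1 u L2 f2 (t + x)"
    "griffith_front T l0 L2 (deriv_on {0..T} L2) \<kappa> c1 (\<lambda>t. deriv_on {-l0..T} f2 (t - L2 t))"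
    using C1_debonding_solution_front[OF sol2 pos \<kappa>] by blast
  interpret f1: griffith_front T l0 L1 "deriv_on {0..T} L1" \<kappa> c1 "\<lambda>t. deriv_on {-l0..T} f1 (t - L1 t)"
    by (fact f1(4))
  interpret f2: griffith_front T l0 L2 "deriv_on {0..T} L2" \<kappa> c1 "\<lambda>t. deriv_on {-l0..T} f2 (t - L2 t)"
    by (fact f2(4))
  have "-l0 < T" using pos by simp
  note unique = solution_unique[OF f1(4) f2(4) lip C1_on_deriv_on(1)[OF f1(1) this]
      C1_on_deriv_on(1)[OF f2(1) this] C1_on_deriv_on(2)[OF f1(1) this] f1(2) f2(2)]
  show L: "L1 t = L2 t" if "t \<in> {0..T}" for t
    using unique(2) that by simp
  then show D: "debonding_domain T L1 = debonding_domain T L2"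
    by (auto simp: debonding_domain_def)
  show "z1 t x = z2 t x" if tx: "(t, x) \<in> debonding_domain T L1" for t x
  proof -
    have t: "t \<in> {0..T}" "0 \<le> x" "x \<le> L1 t"
      using tx by (auto simp: debonding_domain_def)
    have "f1 (t - x) = f2 (t - x)"
      using unique(1)[of "t - x"] t f1.tau_inv(2)[OF t(1)] by auto
    moreover have "wave_g T l0 y0 y1 u L1 f1 (t + x) = wave_g T l0 y0 y1 u L2 f2 (t + x)"
    proof (cases "t + x \<le> l0")
      case False
      then have s: "t + x \<in> {l0..T + L1 T}"
        using t f1.tau_plus_inv(2)[OF t(1)] by auto
      obtain t' where t': "t' \<in> {0..T}" "t' + L1 t' = t + x"
        using f1.tau_plus_inv(3,4)[OF s] by blast
      have "reflect T L1 (t + x) = reflect T L2 (t + x)"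
        using f1.reflect_tau[OF t'(1)] f2.reflect_tau[OF t'(1)] t' L[OF t'(1)] by simp
      moreover have "reflect T L1 (t + x) \<in> {-l0..T}"
        using f1.reflect_bounds(1)[OF s] f1.L_pos[of T] pos by auto
      ultimately show ?thesis
        using unique(1) False by (simp add: wave_g_def)
    qed (simp add: wave_g_def)
    ultimately show ?thesis using f1(3) f2(3) tx D by simp
  qed
qed

section \<open>Control and solution built from a prescribed front\<close>

text \<open>
  The control is read off from a prescribed front and the prescribed derivative \<open>p\<close> of \<open>f\<close>.
\<close>

locale prescribed_front = griffith_front T l0 L V \<kappa> c1 "\<lambda>t. p (t - L t)"
  for T l0 L V \<kappa> c1 and p y0 y1 :: "real \<Rightarrow> real" +
  assumes p_cont: "continuous_on {-l0..T} p"
    and y0: "C1_on {0..l0} y0" and y1: "continuous_on {0..l0} y1"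
    and p_init: "\<And>s. s \<in> {-l0..0} \<Longrightarrow> p s = (y1 (-s) - deriv_on {0..l0} y0 (-s)) / 2"
    and y0_l0: "y0 l0 = 0" and y1_l0: "y1 l0 = - V 0 * deriv_on {0..l0} y0 l0"
begin

text \<open>The subtracted constant normalises \<open>f 0 = 0\<close>, as the first equation of
  \<open>wave_f_eqs\<close> requires.\<close>

definition f :: "real \<Rightarrow> real" where
  "f s = integral {-l0..s} p - integral {-l0..0} p"

text \<open>This is \<open>wave_g\<close> with \<open>y0 0\<close> in place of \<open>u 0\<close>,
  which avoids circularity: \<open>u\<close> is defined from \<open>g\<close>.\<close>

definition g :: "real \<Rightarrow> real" where
  "g s = (if s \<le> l0 then - y0 0 - 1/2 * integral {0..s} (\<lambda>\<sigma>. deriv_on {0..l0} y0 \<sigma> + y1 \<sigma>)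
      else f (reflect T L s))"

definition g' :: "real \<Rightarrow> real" where
  "g' s = (if s \<le> l0 then - 1/2 * (deriv_on {0..l0} y0 s + y1 s)
      else p (reflect T L s) * ((1 - V (tau_plus_inv s)) / (1 + V (tau_plus_inv s))))"

definition u :: "real \<Rightarrow> real" where
  "u s = f s - g s"

definition y :: "real \<Rightarrow> real \<Rightarrow> real" where
  "y t x = f (t - x) - g (t + x)"

lemma f_deriv: "s \<in> {-l0..T} \<Longrightarrow> (f has_real_derivative p s) (at s within {-l0..T})"
  unfolding f_def[abs_def]
  by (auto intro!: derivative_eq_intros integral_has_real_derivative[OF p_cont])

lemma y0_deriv:
  "x \<in> {0..l0} \<Longrightarrow> (y0 has_real_derivative deriv_on {0..l0} y0 x) (at x within {0..l0})"
  "continuous_on {0..l0} (deriv_on {0..l0} y0)"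
  using C1_on_deriv_on[OF y0 l0_pos] by auto

lemma f_init:
  assumes "s \<in> {-l0..0}"
  shows "f s = 1/2 * integral {0..-s} (\<lambda>\<sigma>. deriv_on {0..l0} y0 \<sigma> - y1 \<sigma>)"
proof (rule equal_derivative_within[where c = 0 and x = s])
  let ?h = "\<lambda>\<sigma>. deriv_on {0..l0} y0 \<sigma> - y1 \<sigma>"
  fix r assume r: "r \<in> {-l0..0}"
  show "(f has_real_derivative p r) (at r within {-l0..0})"
    using r T_pos by (intro DERIV_subset[OF f_deriv]) auto
  have "continuous_on {0..l0} ?h"
    by (intro continuous_intros y0_deriv y1)
  then have "((\<lambda>x. integral {0..x} ?h) has_real_derivative ?h (-r)) (at (-r) within {0..l0})"
    using r by (intro integral_has_real_derivative) auto
  then have "((\<lambda>x. integral {0..-x} ?h) has_real_derivative ?h (-r) * (-1)) (at r within {-l0..0})"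
    by (rule has_real_derivative_chain_within) (auto intro!: derivative_eq_intros)
  then show "((\<lambda>s. 1/2 * integral {0..-s} ?h) has_real_derivative p r) (at r within {-l0..0})"
    using p_init[OF r] by (auto intro!: derivative_eq_intros simp: field_simps)
qed (use assms l0_pos in \<open>auto simp: f_def\<close>)

lemma reflect_l0: "reflect T L l0 = -l0" and tau_plus_inv_l0: "tau_plus_inv l0 = 0"
  using reflect_tau[of 0] tau_plus_inv(1)[of 0] T_pos L_0 by auto

text \<open>Continuity of \<open>g\<close> at \<open>l0\<close>. The value \<open>f (-l0)\<close>
  comes from the initial data; the terms in \<open>y1\<close> cancel, and \<open>y0 l0 = 0\<close>
  makes the integral of the derivative of \<open>y0\<close> equal to \<open>- y0 0\<close>.\<close>

lemma g_l0: "f (reflect T L l0) = - y0 0 - 1/2 * integral {0..l0} (\<lambda>\<sigma>. deriv_on {0..l0} y0 \<sigma> + y1 \<sigma>)"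
proof -
  have int: "deriv_on {0..l0} y0 integrable_on {0..l0}" "y1 integrable_on {0..l0}"
    using y0_deriv y1 by (auto intro: integrable_continuous_real)
  have "(deriv_on {0..l0} y0 has_integral (y0 l0 - y0 0)) {0..l0}"
    by (intro fundamental_theorem_of_calculus)
       (use l0_pos y0_deriv in \<open>auto simp: has_real_derivative_iff_has_vector_derivative\<close>)
  then have "integral {0..l0} (deriv_on {0..l0} y0) = - y0 0"
    using y0_l0 by (auto simp: integral_unique)
  then show ?thesis
    using f_init[of "-l0"] l0_pos int
    by (simp add: reflect_l0 integral_diff integral_add field_simps)
qed

text \<open>Continuity of \<open>g'\<close> at \<open>l0\<close>. The compatibility condition on
  \<open>y1 l0\<close> produces the factor \<open>1 + V 0\<close> in \<open>p (-l0)\<close>, which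
  cancels the denominator of the Doppler factor.\<close>

lemma g'_l0: "p (reflect T L l0) * ((1 - V (tau_plus_inv l0)) / (1 + V (tau_plus_inv l0)))
    = - 1/2 * (deriv_on {0..l0} y0 l0 + y1 l0)"
proof -
  have p: "p (-l0) = - (1 + V 0) * deriv_on {0..l0} y0 l0 / 2"
    using p_init[of "-l0"] l0_pos y1_l0 by (simp add: algebra_simps)
  have "(- (1 + v) * d / 2) * ((1 - v) / (1 + v)) = - 1/2 * (d + - v * d)" if "0 \<le> v" for v d :: real
    using that by (simp add: field_simps)
  then show ?thesis
    using V_bounds(1)[of 0] T_pos unfolding reflect_l0 tau_plus_inv_l0 p y1_l0 by simp
qed

lemma Icc_split: "{0..T + L T} = {0..l0} \<union> {l0..T + L T}"
  using l0_pos L_ge[of T] T_pos by auto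

lemma g_eq: "l0 \<le> s \<Longrightarrow> g s = f (reflect T L s)"
  using g_l0 by (auto simp: g_def)

lemma g'_eq:
  "l0 \<le> s \<Longrightarrow> g' s = p (reflect T L s) * ((1 - V (tau_plus_inv s)) / (1 + V (tau_plus_inv s)))"
  using g'_l0 by (auto simp: g'_def)

lemma reflect_range: "s \<in> {l0..T + L T} \<Longrightarrow> reflect T L s \<in> {-l0..T}"
  using reflect_bounds(1)[of s] L_pos[of T] T_pos by auto

lemma g_deriv:
  assumes s: "s \<in> {0..T + L T}"
  shows "(g has_real_derivative g' s) (at s within {0..T + L T})"
  unfolding Icc_split
proof (rule has_real_derivative_within_Un)
  assume s: "s \<in> {0..l0}"
  let ?h = "\<lambda>\<sigma>. deriv_on {0..l0} y0 \<sigma> + y1 \<sigma>"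
  have "continuous_on {0..l0} ?h"
    by (intro continuous_intros y0_deriv y1)
  then have "((\<lambda>x. integral {0..x} ?h) has_real_derivative ?h s) (at s within {0..l0})"
    using s by (intro integral_has_real_derivative) auto
  then have "((\<lambda>s. - y0 0 - 1/2 * integral {0..s} ?h) has_real_derivative g' s) (at s within {0..l0})"
    using s by (auto intro!: derivative_eq_intros simp: g'_def)
  then show "(g has_real_derivative g' s) (at s within {0..l0})"
    by (rule has_field_derivative_transform_within[where d = 1]) (use s in \<open>auto simp: g_def\<close>)
next
  assume s: "s \<in> {l0..T + L T}"
  have "((\<lambda>s. f (reflect T L s)) has_real_derivative g' s) (at s within {l0..T + L T})"
    using s has_real_derivative_chain_within[OF f_deriv[OF reflect_range[OF s]] reflect_deriv[OF s]
        reflect_range]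
    by (simp add: g'_eq)
  then show "(g has_real_derivative g' s) (at s within {l0..T + L T})"
    by (rule has_field_derivative_transform_within[where d = 1]) (use s g_eq in auto)
qed auto

lemma g'_cont: "continuous_on {0..T + L T} g'"
  unfolding Icc_split
proof (rule continuous_on_closed_Un)
  have "continuous_on {0..l0} (\<lambda>s. - 1/2 * (deriv_on {0..l0} y0 s + y1 s))"
    by (intro continuous_intros y0_deriv y1)
  then show "continuous_on {0..l0} g'"
    by (rule continuous_on_cong[THEN iffD1, rotated 2]) (auto simp: g'_def)
  let ?S = "{l0..T + L T}"
  have "continuous_on ?S (\<lambda>s. p (reflect T L s))"
    using reflect_range DERIV_continuous_on[OF reflect_deriv]
    by (intro continuous_on_compose2[OF p_cont]) auto
  moreover have "continuous_on ?S (\<lambda>s. V (tau_plus_inv s))"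
    using tau_plus_inv(3,5) by (intro continuous_on_compose2[OF V_cont]) auto
  moreover have "1 + V (tau_plus_inv s) \<noteq> 0" if "s \<in> ?S" for s
    using V_bounds(1)[OF tau_plus_inv(3)[OF that]] by linarith
  ultimately have "continuous_on ?S
      (\<lambda>s. p (reflect T L s) * ((1 - V (tau_plus_inv s)) / (1 + V (tau_plus_inv s))))"
    by (intro continuous_intros) auto
  then show "continuous_on ?S g'"
    by (rule continuous_on_cong[THEN iffD1, rotated 2]) (auto simp: g'_eq)
qed auto

lemma u_C1: "C1_on {0..T} u"
proof (rule C1_onI[where f' = "\<lambda>s. p s - g' s"])
  have LT: "0 < L T" using L_pos T_pos by simp
  show "(u has_real_derivative p s - g' s) (at s within {0..T})" if "s \<in> {0..T}" for s
    unfolding u_def[abs_def] using that l0_pos LT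
    by (intro DERIV_diff DERIV_subset[OF f_deriv] DERIV_subset[OF g_deriv]) auto
  show "continuous_on {0..T} (\<lambda>s. p s - g' s)"
    using l0_pos LT by (intro continuous_intros continuous_on_subset[OF p_cont]
        continuous_on_subset[OF g'_cont]) auto
qed

lemma domain_range:
  assumes "(t, x) \<in> debonding_domain T L"
  shows "t - x \<in> {-l0..T}" and "t + x \<in> {0..T + L T}"
  using assms tau_inv(2)[of t] tau_plus_inv(2)[of t] by (auto simp: debonding_domain_def)

text \<open>The one-variable derivatives of \<open>f\<close> and \<open>g\<close> are restricted to
  the images of the domain under \<open>t - x\<close> and \<open>t + x\<close>, so the chain rule
  also holds at boundary points.\<close>

lemma y_deriv:
  assumes "(t, x) \<in> debonding_domain T L"
  shows "((\<lambda>(t, x). y t x) has_derivative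
      (\<lambda>(h, k). (p (t - x) - g' (t + x)) * h + (- p (t - x) - g' (t + x)) * k))
      (at (t, x) within debonding_domain T L)"
proof -
  let ?D = "debonding_domain T L"
  have f: "((\<lambda>z. f (fst z - snd z)) has_derivative (\<lambda>z. p (t - x) * (fst z - snd z)))
      (at (t, x) within ?D)"
  proof -
    have "(f has_derivative (*) (p (t - x)))
        (at (fst (t, x) - snd (t, x)) within (\<lambda>z. fst z - snd z) ` ?D)"
      using f_deriv[OF domain_range(1)[OF assms]] domain_range(1)
      by (auto simp: has_field_derivative_def intro: has_derivative_subset)
    then show ?thesis
      using diff_chain_within[of "\<lambda>z. fst z - snd z" "\<lambda>z. fst z - snd z" "(t, x)" ?D f]
      by (force intro!: derivative_eq_intros simp: o_def)
  qed
  have g: "((\<lambda>z. g (fst z + snd z)) has_derivative (\<lambda>z. g' (t + x) * (fst z + snd z)))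
      (at (t, x) within ?D)"
  proof -
    have "(g has_derivative (*) (g' (t + x)))
        (at (fst (t, x) + snd (t, x)) within (\<lambda>z. fst z + snd z) ` ?D)"
      using g_deriv[OF domain_range(2)[OF assms]] domain_range(2)
      by (auto simp: has_field_derivative_def intro: has_derivative_subset)
    then show ?thesis
      using diff_chain_within[of "\<lambda>z. fst z + snd z" "\<lambda>z. fst z + snd z" "(t, x)" ?D g]
      by (force intro!: derivative_eq_intros simp: o_def)
  qed
  show ?thesis
    using has_derivative_diff[OF f g]
    by (simp add: y_def case_prod_unfold algebra_simps)
qed

lemma y_C1: "C1_on_plane (debonding_domain T L) y"
  unfolding C1_on_plane_def
proof (intro exI conjI ballI)
  let ?D = "debonding_domain T L"
  fix z assume "z \<in> ?D"
  then show "((\<lambda>(t, x). y t x) has_derivative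
      (\<lambda>(h, k). (\<lambda>z. p (fst z - snd z) - g' (fst z + snd z)) z * h
         + (\<lambda>z. - p (fst z - snd z) - g' (fst z + snd z)) z * k)) (at z within ?D)"
    using y_deriv[of "fst z" "snd z"] by simp
next
  let ?D = "debonding_domain T L"
  have "continuous_on ?D (\<lambda>z. p (fst z - snd z))" "continuous_on ?D (\<lambda>z. g' (fst z + snd z))"
    using domain_range
    by (auto intro!: continuous_on_compose2[OF p_cont] continuous_on_compose2[OF g'_cont]
        continuous_intros)
  then show "continuous_on ?D (\<lambda>z. p (fst z - snd z) - g' (fst z + snd z))"
    "continuous_on ?D (\<lambda>z. - p (fst z - snd z) - g' (fst z + snd z))"
    by (auto intro!: continuous_intros)
qed

text \<open>From \<open>f 0 = 0\<close> and \<open>g 0 = - y0 0\<close> the control starts at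
  \<open>u 0 = y0 0\<close>, so the substitution made in \<open>g\<close> is consistent.\<close>

lemma wave_g_eq: "wave_g T l0 y0 y1 u L f s = g s"
proof -
  have "u 0 = y0 0"
    using l0_pos by (simp add: u_def g_def f_def)
  then show ?thesis by (simp add: wave_g_def g_def)
qed

lemma solution: "C1_debonding_solution \<kappa> T l0 y0 y1 u L y"
  unfolding C1_debonding_solution_def
proof (intro conjI exI[of _ f])
  show "\<forall>t\<in>{0..T}. 0 < L t" using L_pos by blast
  show "C1_on {0..T} L" using C1_onI[OF L_deriv V_cont] .
  show "C1_on_plane (debonding_domain T L) y" by (rule y_C1)
  show "C1_on {-l0..T} f" using C1_onI[OF f_deriv p_cont] .
  show "L 0 = l0" by (rule L_0)
  have "u 0 = y0 0"
    using l0_pos by (simp add: u_def g_def f_def)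
  then show "wave_f_eqs T l0 y0 y1 u L f"
    using f_init by (auto simp: wave_f_eqs_def u_def g_def)
  show "\<forall>t\<in>{0..T}. deriv_on {0..T} L t
      = front_speed (2 * (deriv_on {-l0..T} f (t - L t))\<^sup>2) (\<kappa> (L t))"
  proof
    fix t assume t: "t \<in> {0..T}"
    then have "t - L t \<in> {-l0..T}"
      using tau_inv(2)[OF t] L_pos[of T] T_pos by auto
    then have "deriv_on {-l0..T} f (t - L t) = p (t - L t)"
      using deriv_on_eq f_deriv T_pos l0_pos by force
    moreover have "deriv_on {0..T} L t = V t"
      using deriv_on_eq[OF L_deriv[OF t]] T_pos t by simp
    ultimately show "deriv_on {0..T} L t
      = front_speed (2 * (deriv_on {-l0..T} f (t - L t))\<^sup>2) (\<kappa> (L t))"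
      using V_eq[OF t] by simp
  qed
  show "\<forall>(t, x)\<in>debonding_domain T L. y t x = f (t - x) - wave_g T l0 y0 y1 u L f (t + x)"
    by (simp add: wave_g_eq y_def)
qed

text \<open>At time \<open>T\<close> the space and time derivatives of \<open>y\<close> are
  \<open>- p (T - x) - g' (T + x)\<close> and \<open>p (T - x) - g' (T + x)\<close>. The resting
  front reflects \<open>T + x\<close> to \<open>T - 2 * lb0 + x\<close> with Doppler factor 1, so
  \<open>p_mid\<close> supplies \<open>g'\<close> and \<open>p_end\<close> the other term. The
  function \<open>z\<close> is there because the derivative within the domain depends only on values
  in it.\<close>

lemma terminal_state:
  assumes lb0: "0 < lb0" "l0 \<le> lb0" "2 * lb0 < T"
    and L: "\<And>t. t \<in> {T - lb0..T} \<Longrightarrow> L t = lb0" and V: "\<And>t. t \<in> {T - lb0..T} \<Longrightarrow> V t = 0"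
    and yb0: "C1_on {0..lb0} yb0" "yb0 lb0 = 0"
    and p_mid: "\<And>x. x \<in> {0..lb0} \<Longrightarrow> p (T - 2 * lb0 + x) = - (yb1 x + deriv_on {0..lb0} yb0 x) / 2"
    and p_end: "\<And>x. x \<in> {0..lb0} \<Longrightarrow> p (T - x) = (yb1 x - deriv_on {0..lb0} yb0 x) / 2"
    and x: "x \<in> {0..lb0}"
  shows "y T x = yb0 x"
    and "(\<And>t x. (t, x) \<in> debonding_domain T L \<Longrightarrow> z t x = y t x)
      \<Longrightarrow> partial_t (debonding_domain T L) z T x = yb1 x"
proof -
  have LT: "L T = lb0" using L lb0 by simp
  have g': "g' (T + x) = - (yb1 x + deriv_on {0..lb0} yb0 x) / 2" if x: "x \<in> {0..lb0}" for x
  proof -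
    \<comment> \<open>The time at which the incoming characteristic through \<open>(T, x)\<close>
      left the front at \<open>lb0\<close>.\<close>
    define t where "t = T + x - lb0"
    have t: "t \<in> {T - lb0..T}" "t \<in> {0..T}" "t + L t = T + x" "t - L t = T - 2 * lb0 + x"
      using x lb0 L[of t] by (auto simp: t_def)
    then have "tau_plus_inv (T + x) = t" "reflect T L (T + x) = T - 2 * lb0 + x"
      using tau_plus_inv(1)[OF t(2)] reflect_tau[OF t(2)] by auto
    then show ?thesis
      using g'_eq[of "T + x"] V[OF t(1)] p_mid[OF x] lb0 x by simp
  qed
  show "y T x = yb0 x"
  proof (rule equal_derivative_within[where c = lb0 and x = x])
    fix x assume x: "x \<in> {0..lb0}"
    show "(yb0 has_real_derivative deriv_on {0..lb0} yb0 x) (at x within {0..lb0})"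
      using C1_on_deriv_on[OF yb0(1) lb0(1)] x by simp
    have "((\<lambda>x. f (T - x)) has_real_derivative p (T - x) * (-1)) (at x within {0..lb0})"
      by (rule has_real_derivative_chain_within[OF f_deriv])
         (use x lb0 l0_pos in \<open>auto intro!: derivative_eq_intros\<close>)
    moreover have "((\<lambda>x. g (T + x)) has_real_derivative g' (T + x) * 1) (at x within {0..lb0})"
      by (rule has_real_derivative_chain_within[OF g_deriv])
         (use x lb0 LT in \<open>auto intro!: derivative_eq_intros\<close>)
    ultimately have "((\<lambda>x. f (T - x) - g (T + x)) has_real_derivative
        p (T - x) * (-1) - g' (T + x) * 1) (at x within {0..lb0})"
      by (rule DERIV_diff)
    moreover have "p (T - x) * (-1) - g' (T + x) * 1 = deriv_on {0..lb0} yb0 x"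
      unfolding g'[OF x] p_end[OF x] by (simp add: field_simps)
    ultimately show "(y T has_real_derivative deriv_on {0..lb0} yb0 x) (at x within {0..lb0})"
      by (simp add: y_def[abs_def])
  next
    have "reflect T L (T + lb0) = T - lb0"
      using reflect_tau[of T] T_pos LT by simp
    then show "y T lb0 = yb0 lb0"
      using yb0 g_eq[of "T + lb0"] lb0 by (simp add: y_def)
  qed (use x lb0 in auto)
  show "partial_t (debonding_domain T L) z T x = yb1 x"
    if z: "\<And>t x. (t, x) \<in> debonding_domain T L \<Longrightarrow> z t x = y t x"
  proof -
    let ?D = "debonding_domain T L" and ?z = "\<lambda>(t, x). z t x"
    have D: "(t, x) \<in> ?D" if "t \<in> {T - lb0..T}" "x \<in> {0..lb0}" for t x
      using that lb0 L[OF that(1)] by (auto simp: debonding_domain_def)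
    have Tx: "(T, x) \<in> ?D" using D[of T x] x lb0 by simp
    have d: "(?z has_derivative
      (\<lambda>(h, k). (p (T - x) - g' (T + x)) * h + (- p (T - x) - g' (T + x)) * k)) (at (T, x) within ?D)"
      by (rule has_derivative_transform[OF Tx _ y_deriv[OF Tx]]) (use z in auto)
    then have "(?z has_derivative frechet_derivative ?z (at (T, x) within ?D)) (at (T, x) within ?D)"
      using frechet_derivative_works differentiableI by blast
    then have "frechet_derivative ?z (at (T, x) within ?D) =
      (\<lambda>(h, k). (p (T - x) - g' (T + x)) * h + (- p (T - x) - g' (T + x)) * k)"
    \<comment> \<open>Uniqueness within the domain needs nearby domain points along both axes. The
      rest of the front supplies a rectangle below time \<open>T\<close>: go back in time, and in
      space go up if \<open>x = 0\<close> and down otherwise.\<close>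
    proof (rule frechet_derivative_unique_within[OF _ d])
      fix i :: "real \<times> real" and e :: real assume i: "i \<in> Basis" and e: "0 < e"
      consider "i = (1, 0)" | "i = (0, 1)" using i by (auto simp: Basis_prod_def)
      then show "\<exists>h. 0 < \<bar>h\<bar> \<and> \<bar>h\<bar> < e \<and> (T, x) + h *\<^sub>R i \<in> ?D"
      proof cases
        case 1
        then show ?thesis
          using D[of "T - min (e/2) lb0" x] e lb0 x by (intro exI[of _ "- min (e/2) lb0"]) auto
      next
        case 2
        show ?thesis
        proof (cases "x = 0")
          case True
          then show ?thesis
            using 2 D[of T "min (e/2) lb0"] e lb0 by (intro exI[of _ "min (e/2) lb0"]) auto
        next
          case False
          then show ?thesis
            using 2 D[of T "x - min (e/2) x"] e lb0 x by (intro exI[of _ "- min (e/2) x"]) auto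
        qed
      qed
    qed
    then have "partial_t ?D z T x = p (T - x) - g' (T + x)"
      by (simp add: partial_t_def)
    also have "\<dots> = yb1 x"
      unfolding g'[OF x] p_end[OF x] by (simp add: field_simps)
    finally show ?thesis .
  qed
qed

end

section \<open>Ingredients of the motion: admissible \<open>f'\<close>, initial branch, speed
  profile, pointwise form of the norm bound\<close>

text \<open>For \<open>V \<noteq> 0\<close> the law inverts to \<open>x\<^sup>2 = R\<close> and
  leaves only a sign; for \<open>V = 0\<close> it is the inequality
  \<open>x\<^sup>2 \<le> R\<close>. The factor \<open>q\<close> expresses both cases by one formula,
  continuous in \<open>q\<close> and \<open>V\<close>, in which \<open>f'\<close> can be steered
  during rests.\<close>

lemma front_speed_iff:
  assumes k: "0 < k" and V: "0 \<le> V" "V < 1"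
  shows "front_speed (2 * x\<^sup>2) k = V \<longleftrightarrow>
    (\<exists>q. \<bar>q\<bar> \<le> 1 \<and> (V \<noteq> 0 \<longrightarrow> \<bar>q\<bar> = 1) \<and> x = q * sqrt (k * (1 + V) / (2 * (1 - V))))"
proof -
  define R where "R = k * (1 + V) / (2 * (1 - V))"
  have R: "0 < R" using assms by (simp add: R_def)
  have pos: "0 < 2 * x\<^sup>2 + k" using k by (simp add: add_nonneg_pos)
  then have *: "(2 * x\<^sup>2 - k) / (2 * x\<^sup>2 + k) = V \<longleftrightarrow> x\<^sup>2 = R"
    using V by (simp add: R_def divide_simps) argo
  have sign: "(2 * x\<^sup>2 - k) / (2 * x\<^sup>2 + k) \<le> 0 \<longleftrightarrow> 2 * x\<^sup>2 \<le> k"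
    using pos by (auto simp: divide_le_0_iff)
  have "front_speed (2 * x\<^sup>2) k = V \<longleftrightarrow> x\<^sup>2 \<le> R \<and> (V \<noteq> 0 \<longrightarrow> x\<^sup>2 = R)"
  proof (cases "V = 0")
    case True
    then show ?thesis using sign by (auto simp: front_speed_def max_def R_def)
  next
    case False
    then show ?thesis using * V by (auto simp: front_speed_def max_def)
  qed
  also have "\<dots> \<longleftrightarrow> \<bar>x\<bar> \<le> sqrt R \<and> (V \<noteq> 0 \<longrightarrow> \<bar>x\<bar> = sqrt R)"
    by (metis real_sqrt_abs real_sqrt_eq_iff real_sqrt_le_iff)
  also have "\<dots> \<longleftrightarrow> (\<exists>q. \<bar>q\<bar> \<le> 1 \<and> (V \<noteq> 0 \<longrightarrow> \<bar>q\<bar> = 1) \<and> x = q * sqrt R)"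
  proof
    assume "\<bar>x\<bar> \<le> sqrt R \<and> (V \<noteq> 0 \<longrightarrow> \<bar>x\<bar> = sqrt R)"
    then show "\<exists>q. \<bar>q\<bar> \<le> 1 \<and> (V \<noteq> 0 \<longrightarrow> \<bar>q\<bar> = 1) \<and> x = q * sqrt R"
      using R by (intro exI[of _ "x / sqrt R"]) (auto simp: abs_divide)
  next
    assume "\<exists>q. \<bar>q\<bar> \<le> 1 \<and> (V \<noteq> 0 \<longrightarrow> \<bar>q\<bar> = 1) \<and> x = q * sqrt R"
    then show "\<bar>x\<bar> \<le> sqrt R \<and> (V \<noteq> 0 \<longrightarrow> \<bar>x\<bar> = sqrt R)"
      using R by (auto simp: abs_mult mult_left_le_one_le)
  qed
  finally show ?thesis by (simp add: R_def)
qed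

lemma continuous_on_front_speed:
  assumes "continuous_on S q" and "continuous_on S k"
    and "\<And>x. x \<in> S \<Longrightarrow> 0 \<le> q x" and "\<And>x. x \<in> S \<Longrightarrow> 0 < k x"
  shows "continuous_on S (\<lambda>x. front_speed (q x) (k x))"
  unfolding front_speed_def
proof (intro continuous_intros assms)
  show "\<forall>x\<in>S. q x + k x \<noteq> 0"
    using assms(3,4) by (metis add_nonneg_pos less_irrefl)
qed

text \<open>As \<open>L ts = ts\<close>, the length \<open>ls\<close> is also the final time. The
  speed is below 1, so \<open>L t - t\<close> decreases from \<open>l0\<close> to 0 and stays where
  the data are continuous; this makes the speed continuous.\<close>

lemma initial_branch_front:
  assumes "initial_branch_end \<kappa> l0 y0 y1 ls ls'"
    and "0 < c1" and \<kappa>: "\<And>x. 0 \<le> x \<Longrightarrow> c1 \<le> \<kappa> x" and lip: "locally_Lipschitz_on {0..} \<kappa>"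
    and "0 < l0" and "C1_on {0..l0} y0" and "continuous_on {0..l0} y1"
  obtains L V where "moving_front ls l0 L V" and "L ls = ls" and "V ls = ls'"
    and "\<And>t. t \<in> {0..ls} \<Longrightarrow> V t = front_speed (2 * ((y1 (L t - t) - deriv_on {0..l0} y0 (L t - t)) / 2)\<^sup>2) (\<kappa> (L t))"
proof -
  let ?q = "\<lambda>L t. 1/2 * (y1 (L t - t) - deriv_on {0..l0} y0 (L t - t))\<^sup>2"
  obtain L ts where ts: "ls = L ts" "L ts = ts" and
    "0 < ts" "L 0 = l0" "ls' = deriv_on {0..ts} L ts"
    "\<forall>t\<in>{0..ts}. (L has_real_derivative front_speed (?q L t) (\<kappa> (L t))) (at t within {0..ts})"
    using assms(1) unfolding initial_branch_end_def by blast
  then have L: "0 < ls" "L 0 = l0" "L ls = ls" "ls' = deriv_on {0..ls} L ls"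
    "\<And>t. t \<in> {0..ls} \<Longrightarrow> (L has_real_derivative front_speed (?q L t) (\<kappa> (L t))) (at t within {0..ls})"
    by auto
  define V where "V t = front_speed (?q L t) (\<kappa> (L t))" for t
  have V_nonneg: "0 \<le> V t" for t by (simp add: V_def front_speed_def)
  have L_deriv: "(L has_real_derivative V t) (at t within {0..ls})" if "t \<in> {0..ls}" for t
    using L(5)[OF that] by (simp add: V_def)
  have L_ge: "l0 \<le> L t" if "t \<in> {0..ls}" for t
  proof -
    have "L 0 \<le> L t"
      by (rule nondecreasing_within[where f = L and f' = V])
         (use that V_nonneg in \<open>auto intro: DERIV_subset[OF L_deriv]\<close>)
    then show ?thesis using L by simp
  qed
  have pos: "0 < \<kappa> (L t)" if "t \<in> {0..ls}" for t
    using \<kappa>[of "L t"] L_ge[OF that] \<open>0 < c1\<close> \<open>0 < l0\<close> by auto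
  have V: "0 \<le> V t" "V t < 1" if "t \<in> {0..ls}" for t
    using front_speed_bounds[OF pos[OF that]] by (auto simp: V_def)
  have range: "L t - t \<in> {0..l0}" if t: "t \<in> {0..ls}" for t
  proof -
    have "L b - b \<le> L a - a" if "0 \<le> a" "a \<le> b" "b \<le> ls" for a b
      by (rule nonincreasing_within[where f = "\<lambda>t. L t - t" and f' = "\<lambda>t. V t - 1"])
         (use that V in \<open>auto intro!: derivative_eq_intros DERIV_subset[OF L_deriv] simp: less_imp_le\<close>)
    from this[of 0 t] this[of t ls] show ?thesis using t L by auto
  qed
  have cont: "continuous_on {0..ls} L" using L_deriv DERIV_continuous_on by blast
  have V_cont: "continuous_on {0..ls} V"
    unfolding V_def
  proof (rule continuous_on_front_speed)
    show "continuous_on {0..ls} (?q L)"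
      using range C1_on_deriv_on(2)[OF assms(6,5)] assms(7) cont
      by (auto intro!: continuous_intros continuous_on_compose2[where s = "{0..ls}" and f = "\<lambda>t. L t - t"])
    show "continuous_on {0..ls} (\<lambda>t. \<kappa> (L t))"
      by (rule continuous_on_compose2[OF continuous_on_locally_Lipschitz[OF lip] cont])
         (use L_ge \<open>0 < l0\<close> in force)
  qed (use pos in auto)
  show ?thesis
  proof
    show "moving_front ls l0 L V"
      by unfold_locales (use L L_deriv V_cont V \<open>0 < l0\<close> in auto)
    show "V ls = ls'"
      using L deriv_on_eq[OF L_deriv[of ls]] by simp
  qed (use L in \<open>auto simp: V_def power_divide\<close>)
qed

text \<open>The motion starts with speed \<open>a\<close> and covers the distance \<open>d\<close>
  in time \<open>D\<close>: a brake \<open>w\<close>, then a trapezoidal bump \<open>b\<close>. The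
  front rests near \<open>D\<close>, and near 0 if \<open>a = 0\<close>; there \<open>q\<close> may
  pass between the prescribed end values and a fixed sign \<open>\<sigma>\<close>.\<close>

lemma speed_profile:
  fixes a d D p0 p1 :: real
  assumes a: "0 \<le> a" "a < 1" and d: "0 \<le> d" "d < D" and ad: "a \<noteq> 0 \<Longrightarrow> 0 < d"
    and p0: "\<bar>p0\<bar> \<le> 1" "a \<noteq> 0 \<Longrightarrow> \<bar>p0\<bar> = 1" and p1: "\<bar>p1\<bar> \<le> 1"
  obtains v q where "continuous_on UNIV v" "continuous_on UNIV q"
    and "v 0 = a" "q 0 = p0" "q D = p1" "integral {0..D} v = d"
    and "\<And>s. 0 \<le> v s" "\<And>s. v s < 1" "\<And>s. D \<le> s \<Longrightarrow> v s = 0"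
    and "\<And>s. \<bar>q s\<bar> \<le> 1" "\<And>s. 0 \<le> s \<Longrightarrow> v s \<noteq> 0 \<Longrightarrow> \<bar>q s\<bar> = 1"
proof -
  \<comment> \<open>\<open>8 * \<epsilon> \<le> D - d\<close> gives the bump an area of at least
    \<open>D - 4 * \<epsilon> > d\<close>. The bound by \<open>d / 2\<close> keeps the braking
    distance within \<open>d\<close>.\<close>
  define \<epsilon> where "\<epsilon> = (if a = 0 then (D - d) / 8 else min ((D - d) / 8) (d / 2))"
  have \<epsilon>: "0 < \<epsilon>" "8 * \<epsilon> \<le> D - d" "a * \<epsilon> \<le> d"
  proof -
    show "0 < \<epsilon>" "8 * \<epsilon> \<le> D - d" using d ad by (auto simp: \<epsilon>_def min_def)
    then show "a * \<epsilon> \<le> d"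
      using a d mult_right_mono[of a 1 \<epsilon>] by (cases "a = 0") (auto simp: \<epsilon>_def)
  qed
  \<comment> \<open>On \<open>[0, D]\<close>, \<open>w\<close> falls from 1 to 0 over
    \<open>[0, \<epsilon>]\<close>, while \<open>b\<close> is 1 on
    \<open>[2 \<epsilon>, D - 2 \<epsilon>]\<close> and vanishes outside
    \<open>[\<epsilon>, D - \<epsilon>]\<close>. Thus at most one of them contributes at a time,
    which keeps the speed below 1.\<close>
  define w where "w s = max 0 (min 1 (1 - s / \<epsilon>))" for s
  define b where "b s = max 0 (min 1 (min (s / \<epsilon> - 1) ((D - s) / \<epsilon> - 1)))" for s
  have cont: "continuous_on S w" "continuous_on S b" for S
    unfolding w_def b_def using \<epsilon> by (auto intro!: continuous_intros)
  have int: "w integrable_on {x..z}" "b integrable_on {x..z}" for x z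
    using cont by (auto intro: integrable_continuous_real)
  have w: "0 \<le> w s" "w s \<le> 1" "\<epsilon> \<le> s \<Longrightarrow> w s = 0" for s
    using \<epsilon> by (auto simp: w_def)
  have b: "0 \<le> b s" "b s \<le> 1" "s \<le> \<epsilon> \<Longrightarrow> b s = 0" "D - \<epsilon> \<le> s \<Longrightarrow> b s = 0" for s
  proof -
    show "b s = 0" if "s \<le> \<epsilon>"
    proof -
      have "s / \<epsilon> \<le> 1" using that \<epsilon> by simp
      then show ?thesis unfolding b_def by linarith
    qed
    show "b s = 0" if "D - \<epsilon> \<le> s"
    proof -
      have "(D - s) / \<epsilon> \<le> 1" using that \<epsilon> by simp
      then show ?thesis unfolding b_def by linarith
    qed
  qed (auto simp: b_def)
  define I where "I = integral {0..D} w"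
  define J where "J = integral {0..D} b"
  have I: "0 \<le> I" "I \<le> \<epsilon>"
  proof -
    show "0 \<le> I" unfolding I_def using w int by (intro integral_nonneg) auto
    have "I = integral {0..\<epsilon>} w + integral {\<epsilon>..D} w"
      unfolding I_def using \<epsilon> d int by (intro Henstock_Kurzweil_Integration.integral_combine[symmetric]) auto
    moreover have "integral {\<epsilon>..D} w = 0"
      using w(3) by (intro integral_unique has_integral_is_0) auto
    moreover have "integral {0..\<epsilon>} w \<le> integral {0..\<epsilon>} (\<lambda>_. 1)"
      using w int by (intro integral_le) auto
    ultimately show "I \<le> \<epsilon>" using \<epsilon> by simp
  qed
  have J: "d < J"
  proof -
    have "integral {2 * \<epsilon>..D - 2 * \<epsilon>} (\<lambda>_. 1) = integral {2 * \<epsilon>..D - 2 * \<epsilon>} b"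
      using \<epsilon> by (intro integral_cong) (auto simp: b_def field_simps)
    also have "\<dots> \<le> J"
      unfolding J_def using int b \<epsilon> by (intro integral_subset_le) auto
    finally show ?thesis using \<epsilon> d by simp
  qed
  \<comment> \<open>The height that makes the bump cover what the braking phase leaves of
    \<open>d\<close>; \<open>J > d\<close> yields \<open>c < 1\<close>.\<close>
  define c where "c = (d - a * I) / J"
  have aI: "0 \<le> a * I" "a * I \<le> d"
    using a I \<epsilon> mult_left_mono[of I \<epsilon> a] by auto
  have c: "0 \<le> c" "c < 1"
    using aI J d by (auto simp: c_def)
  define v where "v s = a * w s + c * b s" for s
  \<comment> \<open>The sign of \<open>f'\<close> while the front moves. Initial motion fixes it as
    \<open>p0\<close>; after an initial rest either sign would do.\<close>
  define \<sigma> where "\<sigma> = (if a = 0 then 1 else p0)"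
  have \<sigma>: "\<bar>\<sigma>\<bar> = 1" using p0 by (auto simp: \<sigma>_def)
  define q where "q s = \<sigma> + (p0 - \<sigma>) * w s + (p1 - \<sigma>) * w (D - s)" for s
  have convex: "\<bar>\<sigma> + (r - \<sigma>) * x\<bar> \<le> 1" if "\<bar>r\<bar> \<le> 1" "0 \<le> x" "x \<le> 1" for r x
  proof -
    have "\<bar>\<sigma> + (r - \<sigma>) * x\<bar> = \<bar>\<sigma> * (1 - x) + r * x\<bar>" by (simp add: algebra_simps)
    also have "\<dots> \<le> \<bar>\<sigma>\<bar> * (1 - x) + \<bar>r\<bar> * x"
      using that by (metis abs_mult abs_of_nonneg abs_triangle_ineq diff_ge_0_iff_ge)
    also have "\<dots> \<le> 1" using that \<sigma> mult_right_mono[of "\<bar>r\<bar>" 1 x] by simp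
    finally show ?thesis .
  qed
  show ?thesis
  proof
    show "continuous_on UNIV v"
      unfolding v_def by (intro continuous_intros cont)
    show "continuous_on UNIV q"
      unfolding q_def
      by (intro continuous_intros cont continuous_on_compose2[OF cont(1)[of UNIV]]) auto
    show "v 0 = a" using \<epsilon> b(3)[of 0] by (simp add: v_def w_def)
    show "q 0 = p0" using \<epsilon> d w(3)[of D] by (simp add: q_def w_def)
    show "q D = p1" using \<epsilon> d w(3)[of D] by (simp add: q_def w_def)
    have "integral {0..D} v = a * I + c * J"
      unfolding v_def I_def J_def
      by (subst integral_add) (auto intro!: int integrable_on_mult_right)
    then show "integral {0..D} v = d" using J d by (simp add: c_def)
    show "0 \<le> v s" for s using a b c w by (simp add: v_def)
    show "v s < 1" for s
    proof (cases "s \<le> \<epsilon>")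
      case True
      then show ?thesis using b(3) a w mult_left_mono[of "w s" 1 a] by (simp add: v_def)
    next
      case False
      then show ?thesis using w(3) c b mult_left_mono[of "b s" 1 c] by (simp add: v_def)
    qed
    show "v s = 0" if "D \<le> s" for s
      using w(3) b(4) that \<epsilon> d by (simp add: v_def)
    show "\<bar>q s\<bar> \<le> 1" for s
    proof (cases "s \<le> \<epsilon>")
      case True
      then have "w (D - s) = 0" using w(3) \<epsilon> d by simp
      then show ?thesis using convex[OF p0(1) w(1,2)] by (simp add: q_def)
    next
      case False
      then have "w s = 0" using w(3) by simp
      then show ?thesis using convex[OF p1 w(1,2)] by (simp add: q_def)
    qed
    show "\<bar>q s\<bar> = 1" if "0 \<le> s" "v s \<noteq> 0" for s
    proof -
      have "s < D - \<epsilon>"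
        using that w(3)[of s] b(4)[of s] \<epsilon> d by (force simp: v_def)
      then have "w (D - s) = 0" using w(3) by simp
      moreover have "(p0 - \<sigma>) * w s = 0"
        using that b(3)[of s] w(3)[of s] by (cases "s \<le> \<epsilon>") (auto simp: v_def \<sigma>_def)
      ultimately have "q s = \<sigma>" unfolding q_def by auto
      then show ?thesis using \<sigma> by simp
    qed
  qed
qed

text \<open>The set where a continuous function violates an almost everywhere bound is relatively
  open, so if nonempty it contains a nondegenerate interval and cannot be null.\<close>

lemma Linf_norm_on_bound:
  assumes cont: "continuous_on {0..b} h" and "0 < b" and "0 \<le> K"
    and norm: "(Linf_norm_on {0..b} h)\<^sup>2 \<le> ereal K" and x: "x \<in> {0..b}"
  shows "(h x)\<^sup>2 \<le> K"
proof (rule ccontr)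
  assume "\<not> (h x)\<^sup>2 \<le> K"
  have "AE x in lebesgue_on {0..b}. ereal \<bar>h x\<bar> \<le> Linf_norm_on {0..b} h"
    unfolding Linf_norm_on_def by (rule esssup_AE)
  then have "AE x in lebesgue_on {0..b}. (h x)\<^sup>2 \<le> K"
  proof eventually_elim
    case (elim x)
    have "ereal ((h x)\<^sup>2) = (ereal \<bar>h x\<bar>)\<^sup>2" by simp
    also have "\<dots> \<le> (Linf_norm_on {0..b} h)\<^sup>2"
      using elim unfolding power2_eq_square by (intro ereal_mult_mono) (auto intro: order_trans[rotated])
    also have "\<dots> \<le> ereal K" by (rule norm)
    finally show ?case by simp
  qed
  then have "AE x in lebesgue. x \<in> {0..b} \<longrightarrow> (h x)\<^sup>2 \<le> K"
    by (subst (asm) AE_restrict_space_iff) auto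
  then have null: "negligible {x \<in> {0..b}. K < (h x)\<^sup>2}"
    by (auto simp: negligible_iff_null_sets AE_iff_null_sets not_le eventually_ae_filter
        intro: null_sets_completion_subset elim!: rev_subsetD)
  have "openin (top_of_set {0..b}) ({0..b} \<inter> (\<lambda>x. (h x)\<^sup>2) -` {K<..})"
    using cont by (intro continuous_openin_preimage_gen continuous_intros) auto
  then obtain e where e: "0 < e" "\<And>z. z \<in> {0..b} \<Longrightarrow> dist z x < e \<Longrightarrow> K < (h z)\<^sup>2"
    using x \<open>\<not> (h x)\<^sup>2 \<le> K\<close> unfolding openin_euclidean_subtopology_iff by force
  \<comment> \<open>Clipping to \<open>{0..b}\<close> leaves \<open>l < r\<close> even when
    \<open>x\<close> is an endpoint.\<close>
  define l where "l = max 0 (x - e / 2)"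
  define r where "r = min b (x + e / 2)"
  have "l < r" using e x \<open>0 < b\<close> by (auto simp: l_def r_def)
  moreover have "{l..r} \<subseteq> {x \<in> {0..b}. K < (h x)\<^sup>2}"
    using e by (auto simp: l_def r_def dist_real_def intro!: e(2))
  then have "negligible {l..r}" using null negligible_subset by blast
  ultimately show False
    using negligible_interval(1)[of l r] by (simp add: box_real)
qed

section \<open>Reaching the target: initial branch, transition and rest are joined\<close>

theorem corollary4p12:
  fixes c1 c2 l0 ls ls' T lb0 :: real
    and \<kappa> y0 y1 yb0 yb1 :: "real \<Rightarrow> real"
  assumes "0 < c1" and "c1 < c2"
    and "locally_Lipschitz_on {0..} \<kappa>"
    and "\<forall>x\<ge>0. \<kappa> x \<in> {c1..c2}"
    and "l0 > 0"
    and "C1_on {0..l0} y0" and "continuous_on {0..l0} y1"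
    and "y0 l0 = 0"
    and "y1 l0 = - front_speed (1/2 * (y1 l0 - deriv_on {0..l0} y0 l0)\<^sup>2) (\<kappa> l0)
                   * deriv_on {0..l0} y0 l0"
    and "initial_branch_end \<kappa> l0 y0 y1 ls ls'"
    and "T > 0" and "lb0 > 0"
    and "C1_on {0..lb0} yb0" and "continuous_on {0..lb0} yb1"
    and "if ls' = 0 then lb0 \<ge> ls else lb0 > ls"
    and "T > 2 * lb0"
    and "yb0 lb0 = 0" and "yb1 lb0 = 0"
    and "(Linf_norm_on {0..lb0} (\<lambda>x. yb1 x + deriv_on {0..lb0} yb0 x))\<^sup>2 \<le> ereal (2 * \<kappa> lb0)"
  shows "\<exists>u. C1_on {0..T} u \<and>
    (\<exists>L y. C1_debonding_solution \<kappa> T l0 y0 y1 u L y) \<and>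
    (\<forall>L y. C1_debonding_solution \<kappa> T l0 y0 y1 u L y \<longrightarrow>
       L T = lb0 \<and>
       (\<forall>x\<in>{0..lb0}. y T x = yb0 x) \<and>
       (\<forall>x\<in>{0..lb0}. partial_t (debonding_domain T L) y T x = yb1 x))"
proof -
  have \<kappa>: "c1 \<le> \<kappa> x" if "0 \<le> x" for x using assms(4) that by simp
  note lip = assms(3)
  have \<kappa>_cont: "continuous_on {0..} \<kappa>" using continuous_on_locally_Lipschitz[OF lip] .
  obtain L0 V0 where front0: "moving_front ls l0 L0 V0" and L0_ls: "L0 ls = ls" "V0 ls = ls'"
    and V0_eq: "\<And>t. t \<in> {0..ls} \<Longrightarrow> V0 t
      = front_speed (2 * ((y1 (L0 t - t) - deriv_on {0..l0} y0 (L0 t - t)) / 2)\<^sup>2) (\<kappa> (L0 t))"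
    using initial_branch_front[OF assms(10,1) \<kappa> lip assms(5-7)] by blast
  interpret i: moving_front ls l0 L0 V0 by (fact front0)
  \<comment> \<open>\<open>w0\<close>, \<open>ym\<close> and \<open>yp\<close> are the values of
    \<open>f'\<close> forced by the data on \<open>[-l0, 0]\<close>,
    \<open>[T - 2 lb0, T - lb0]\<close> and \<open>[T - lb0, T]\<close>, the first and the last in
    reversed direction.\<close>
  define w0 where "w0 x = (y1 x - deriv_on {0..l0} y0 x) / 2" for x
  define ym where "ym x = - (yb1 x + deriv_on {0..lb0} yb0 x) / 2" for x
  define yp where "yp x = (yb1 x - deriv_on {0..lb0} yb0 x) / 2" for x
  note yb0' = C1_on_deriv_on(2)[OF \<open>C1_on {0..lb0} yb0\<close> \<open>0 < lb0\<close>]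
  have w0_cont: "continuous_on {0..l0} w0"
    unfolding w0_def by (intro continuous_intros assms C1_on_deriv_on(2)) auto
  have ym_cont: "continuous_on {0..lb0} ym" and yp_cont: "continuous_on {0..lb0} yp"
    unfolding ym_def yp_def by (auto intro!: continuous_intros assms yb0')
  have ls: "0 < ls" "l0 \<le> ls" "ls \<le> lb0"
    using i.T_pos i.L_ge[of ls] L0_ls assms(15) by (auto split: if_splits)
  have ls': "0 \<le> ls'" "ls' < 1" using i.V_bounds[of ls] L0_ls ls by auto
  have \<kappa>_pos: "0 < \<kappa> x" if "0 \<le> x" for x using \<kappa>[OF that] \<open>0 < c1\<close> by simp
  \<comment> \<open>The factor 1/2 in \<open>ym\<close> turns the norm bound into
    \<open>2 * (ym x)\<^sup>2 \<le> \<kappa> lb0\<close>, the condition for rest at length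
    \<open>lb0\<close>.\<close>
  have ym_bound: "front_speed (2 * (ym x)\<^sup>2) (\<kappa> lb0) = 0" if "x \<in> {0..lb0}" for x
  proof -
    have "(yb1 x + deriv_on {0..lb0} yb0 x)\<^sup>2 \<le> 2 * \<kappa> lb0"
      by (rule Linf_norm_on_bound[OF _ \<open>0 < lb0\<close> _ assms(19) that])
         (use \<kappa>_pos[of lb0] \<open>0 < lb0\<close> in \<open>auto intro!: continuous_intros assms yb0'\<close>)
    moreover have "(ym x)\<^sup>2 = (yb1 x + deriv_on {0..lb0} yb0 x)\<^sup>2 / 4"
      by (simp add: ym_def power2_eq_square field_simps)
    ultimately have "2 * (ym x)\<^sup>2 \<le> \<kappa> lb0" by linarith
    then show ?thesis
      using \<kappa>_pos[of lb0] \<open>0 < lb0\<close> by (simp add: front_speed_def divide_le_0_iff)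
  qed
  \<comment> \<open>\<open>p0\<close> and \<open>p1\<close> are the factors \<open>q\<close> must
    take at the two ends of the transition so that \<open>f'\<close> matches \<open>w0 0\<close> and
    \<open>ym 0\<close>.\<close>
  have "front_speed (2 * (w0 0)\<^sup>2) (\<kappa> ls) = ls'"
    using V0_eq[of ls] ls L0_ls by (simp add: w0_def)
  then obtain p0 where p0: "\<bar>p0\<bar> \<le> 1" "ls' \<noteq> 0 \<longrightarrow> \<bar>p0\<bar> = 1"
      "w0 0 = p0 * sqrt (\<kappa> ls * (1 + ls') / (2 * (1 - ls')))"
    using front_speed_iff[of "\<kappa> ls" ls' "w0 0"] \<kappa>_pos ls ls' by auto
  obtain p1 where p1: "\<bar>p1\<bar> \<le> 1" "ym 0 = p1 * sqrt (\<kappa> lb0 * (1 + 0) / (2 * (1 - 0)))"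
    using front_speed_iff[of "\<kappa> lb0" 0 "ym 0"] ym_bound[of 0] \<kappa>_pos \<open>0 < lb0\<close> by auto
  \<comment> \<open>The transition has time \<open>D\<close> for the distance
    \<open>lb0 - ls\<close>; \<open>lb0 - ls < D\<close> is exactly \<open>T > 2 * lb0\<close>. A
    front arriving with \<open>ls' \<noteq> 0\<close> has room to brake because then
    \<open>ls < lb0\<close>.\<close>
  define D where "D = T - lb0 - ls"
  have D: "0 \<le> lb0 - ls" "lb0 - ls < D" "ls' \<noteq> 0 \<Longrightarrow> 0 < lb0 - ls" "\<bar>p0\<bar> \<le> 1" "ls' \<noteq> 0 \<Longrightarrow> \<bar>p0\<bar> = 1"
    using assms(15,16) ls p0 by (auto simp: D_def)
  obtain v q where v: "continuous_on UNIV v" "v 0 = ls'" "integral {0..D} v = lb0 - ls"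
      "\<And>s. 0 \<le> v s" "\<And>s. v s < 1" "\<And>s. D \<le> s \<Longrightarrow> v s = 0"
    and q: "continuous_on UNIV q" "q 0 = p0" "q D = p1"
      "\<And>s. \<bar>q s\<bar> \<le> 1" "\<And>s. 0 \<le> s \<Longrightarrow> v s \<noteq> 0 \<Longrightarrow> \<bar>q s\<bar> = 1"
    using speed_profile[OF ls' D p1(1)] by blast
  define L where "L t = (if t \<le> ls then L0 t else ls + integral {0..t - ls} v)" for t
  define V where "V t = (if t \<le> ls then V0 t else v (t - ls))" for t
  \<comment> \<open>The later formulas also hold at \<open>t = ls\<close>, since
    \<open>L0 ls = ls\<close> and \<open>v 0 = ls'\<close>; this allows gluing.\<close>
  have L_late: "L t = ls + integral {0..t - ls} v" "V t = v (t - ls)" if "ls \<le> t" for t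
    using that L0_ls v(2) by (auto simp: L_def V_def)
  have T: "ls < T" using assms(16) ls \<open>0 < lb0\<close> by simp
  then have split: "{0..T} = {0..ls} \<union> {ls..T}" using ls by auto
  have front: "moving_front T l0 L V"
  proof
    show "0 < T" "0 < l0" using assms by auto
    show "L 0 = l0" using i.L_0 ls by (simp add: L_def)
    show "0 \<le> V t" "V t < 1" if "t \<in> {0..T}" for t
      using i.V_bounds[of t] v(4,5) that by (auto simp: V_def)
    show "(L has_real_derivative V t) (at t within {0..T})" for t
      unfolding split
    proof (rule has_real_derivative_within_Un)
      assume t: "t \<in> {0..ls}"
      show "(L has_real_derivative V t) (at t within {0..ls})"
        using t i.L_deriv[OF t]
        by (auto intro: has_field_derivative_transform_within[where d = 1 and f = L0]
            simp: L_def V_def)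
    next
      assume t: "t \<in> {ls..T}"
      have "((\<lambda>s. integral {0..s} v) has_real_derivative v (t - ls)) (at (t - ls) within {0..T - ls})"
        using t by (intro integral_has_real_derivative continuous_on_subset[OF v(1)]) auto
      then have "((\<lambda>t. integral {0..t - ls} v) has_real_derivative v (t - ls) * 1) (at t within {ls..T})"
        by (rule has_real_derivative_chain_within) (auto intro!: derivative_eq_intros)
      then have "((\<lambda>t. ls + integral {0..t - ls} v) has_real_derivative V t) (at t within {ls..T})"
        using L_late t by (auto intro!: derivative_eq_intros)
      then show "(L has_real_derivative V t) (at t within {ls..T})"
        by (rule has_field_derivative_transform_within[where d = 1]) (use t L_late in auto)
    qed auto
    show "continuous_on {0..T} V"
      unfolding split
    proof (rule continuous_on_closed_Un)
      show "continuous_on {0..ls} V"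
        using i.V_cont by (rule continuous_on_eq) (auto simp: V_def)
      have "continuous_on {ls..T} (\<lambda>t. v (t - ls))"
        by (intro continuous_on_compose2[OF v(1)] continuous_intros) auto
      then show "continuous_on {ls..T} V"
        by (rule continuous_on_eq) (auto simp: L_late)
    qed auto
  qed
  interpret m: moving_front T l0 L V by (fact front)
  have L_end: "L t = lb0" "V t = 0" if "t \<in> {T - lb0..T}" for t
  proof -
    have t: "ls \<le> t" "D \<le> t - ls" using that D ls by (auto simp: D_def)
    have "integral {0..D} v + integral {D..t - ls} v = integral {0..t - ls} v"
      using t D
      by (intro Henstock_Kurzweil_Integration.integral_combine integrable_continuous_real
          continuous_on_subset[OF v(1)]) auto
    moreover have "integral {D..t - ls} v = 0"
      using v(6) by (intro integral_unique has_integral_is_0) auto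
    ultimately show "L t = lb0" using L_late(1)[OF t(1)] v(3) by simp
    show "V t = 0" using L_late(2)[OF t(1)] v(6) t by simp
  qed
  define F where "F t = q (t - ls) * sqrt (\<kappa> (L t) * (1 + V t) / (2 * (1 - V t)))" for t
  \<comment> \<open>The rest begins at time \<open>B\<close>, when \<open>t - L t = A\<close>. By
    time \<open>T\<close> the argument \<open>t - L t\<close> has only reached \<open>B\<close>, so
    Griffith's criterion constrains \<open>p\<close> up to \<open>B\<close> but leaves the target
    free to prescribe it on \<open>[B, T]\<close>.\<close>
  define A where "A = T - 2 * lb0"
  define B where "B = T - lb0"
  have AB: "0 < A" "A \<le> B" "B \<le> T" "B = A + lb0" "ls \<le> B" "0 \<le> B"
    using assms(16) \<open>0 < lb0\<close> ls D by (auto simp: A_def B_def)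
  have L_ls: "L ls = ls" using L0_ls by (simp add: L_def)
  have L_B: "L B = lb0" "V B = 0" "L T = lb0" using L_end \<open>0 < lb0\<close> by (auto simp: B_def)
  have tau_0: "m.tau_inv 0 = ls" and tau_A: "m.tau_inv A = B"
    using m.tau_inv(1)[of ls] m.tau_inv(1)[of B] L_ls L_B ls T AB by (auto simp: A_def B_def)
  \<comment> \<open>The four pieces fit together: at 0 by \<open>q 0 = p0\<close>, at
    \<open>A\<close> by \<open>q D = p1\<close>, and at \<open>B\<close> because
    \<open>yb1 lb0 = 0\<close> gives \<open>ym lb0 = yp lb0\<close>.\<close>
  define p where "p s = (if s \<le> 0 then w0 (- s) else if s \<le> A then F (m.tau_inv s)
    else if s \<le> B then ym (s - A) else yp (T - s))" for s
  have p_eq1: "p s = w0 (- s)" if "s \<le> 0" for s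
    using that by (simp add: p_def)
  have p_eq2: "p s = F (m.tau_inv s)" if "0 \<le> s" "s \<le> A" for s
    using that p0(3) q(2) L_ls ls(1) L_late(2)[of ls] v(2) by (auto simp: p_def F_def tau_0)
  have "B - ls = D" by (simp add: B_def D_def)
  then have F_B: "F B = ym 0" using p1(2) q(3) L_B by (simp add: F_def)
  have p_eq3: "p s = ym (s - A)" if "A \<le> s" "s \<le> B" for s
    using that AB p_eq2[of A] F_B by (cases "s = A") (auto simp: p_def tau_A)
  have p_eq4: "p s = yp (T - s)" if "B \<le> s" for s
  proof (cases "s = B")
    case True
    have "ym lb0 = yp lb0" using \<open>yb1 lb0 = 0\<close> by (simp add: ym_def yp_def)
    then show ?thesis using True p_eq3[of B] AB by (simp add: B_def)
  qed (use that AB in \<open>auto simp: p_def\<close>)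
  have tau_mono: "t - L t \<le> t' - L t'" if "0 \<le> t" "t \<le> t'" "t' \<le> T" for t t'
    by (rule nondecreasing_within[where f = "\<lambda>t. t - L t" and f' = "\<lambda>t. 1 - V t"])
       (use that m.V_bounds in \<open>auto intro!: DERIV_subset[OF m.tau_deriv(1)] simp: less_imp_le\<close>)
  have F_cont: "continuous_on {ls..B} F"
  proof -
    have sub: "{ls..B} \<subseteq> {0..T}" using ls AB by auto
    have "continuous_on {0..T} (\<lambda>t. \<kappa> (L t))"
      by (rule continuous_on_compose2[OF \<kappa>_cont DERIV_continuous_on[OF m.L_deriv]])
         (use m.L_pos in \<open>auto simp: less_imp_le\<close>)
    moreover have "continuous_on {ls..B} (\<lambda>t. q (t - ls))"
      by (intro continuous_on_compose2[OF q(1)] continuous_intros) auto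
    moreover have "2 * (1 - V t) \<noteq> 0" if "t \<in> {ls..B}" for t
      using m.V_bounds(2)[of t] that sub by fastforce
    ultimately show ?thesis
      unfolding F_def using sub
      by (intro continuous_intros continuous_on_subset[OF m.V_cont]) (auto intro: continuous_on_subset)
  qed
  have p_cont: "continuous_on {-l0..T} p"
  proof -
    have "continuous_on {-l0..0} (\<lambda>s. w0 (- s))"
      by (intro continuous_on_compose2[OF w0_cont] continuous_intros) auto
    then have 1: "continuous_on {-l0..0} p"
      by (rule continuous_on_eq) (simp add: p_eq1)
    have "m.tau_inv s \<in> {ls..B}" if "s \<in> {0..A}" for s
    proof -
      have s: "s \<in> {-l0..T - L T}" using that \<open>0 < l0\<close> AB L_B by (auto simp: B_def)
      define t where "t = m.tau_inv s"
      have t: "0 \<le> t" "t \<le> T" "t - L t = s"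
        using m.tau_inv(3,4)[OF s] by (auto simp: t_def)
      \<comment> \<open>\<open>tau_mono\<close> is not strict, so a violation only forces
        \<open>s\<close> to the endpoint value, where \<open>m.tau_inv\<close> is already
        known.\<close>
      have "ls \<le> t"
      proof (rule ccontr)
        assume "\<not> ls \<le> t"
        moreover from this have "s = 0"
          using tau_mono[of t ls] t L_ls T that by auto
        ultimately show False using tau_0 by (simp add: t_def)
      qed
      moreover have "t \<le> B"
      proof (rule ccontr)
        assume "\<not> t \<le> B"
        moreover from this have "s = A"
          using tau_mono[of B t] t L_B AB that by auto
        ultimately show False using tau_A by (simp add: t_def)
      qed
      ultimately show ?thesis by (simp add: t_def)
    qed
    then have "continuous_on {0..A} (\<lambda>s. F (m.tau_inv s))"
      using AB L_B \<open>0 < l0\<close>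
      by (intro continuous_on_compose2[OF F_cont] continuous_on_subset[OF m.tau_inv(5)]) (auto simp: B_def)
    then have 2: "continuous_on {0..A} p"
      by (rule continuous_on_eq) (simp add: p_eq2)
    have "continuous_on {A..B} (\<lambda>s. ym (s - A))"
      using AB by (intro continuous_on_compose2[OF ym_cont] continuous_intros) auto
    then have 3: "continuous_on {A..B} p"
      by (rule continuous_on_eq) (simp add: p_eq3)
    have "continuous_on {B..T} (\<lambda>s. yp (T - s))"
      by (intro continuous_on_compose2[OF yp_cont] continuous_intros) (auto simp: B_def)
    then have 4: "continuous_on {B..T} p"
      by (rule continuous_on_eq) (simp add: p_eq4)
    have "{-l0..T} = {-l0..0} \<union> {0..A} \<union> {A..B} \<union> {B..T}"
      using AB \<open>0 < l0\<close> by auto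
    then show ?thesis
      using 1 2 3 4 by (simp add: continuous_on_closed_Un closed_Un)
  qed
  have V_eq: "V t = front_speed (2 * (p (t - L t))\<^sup>2) (\<kappa> (L t))" if t: "t \<in> {0..T}" for t
  proof -
    \<comment> \<open>The three phases rely on the initial branch equation, on
      \<open>front_speed_iff\<close>, and on \<open>ym_bound\<close>, respectively.\<close>
    consider "t \<le> ls" | "ls \<le> t" "t \<le> B" | "B \<le> t" by linarith
    then show ?thesis
    proof cases
      case 1
      then have "t - L t \<le> 0" using tau_mono[of t ls] t T L_ls by auto
      then show ?thesis
        using V0_eq[of t] 1 t by (simp add: p_eq1 w0_def L_def V_def)
    next
      case 2
      then have "0 \<le> t - L t" "t - L t \<le> A"
        using tau_mono[of ls t] tau_mono[of t B] t AB ls L_ls L_B by (auto simp: A_def B_def)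
      then have p: "p (t - L t) = q (t - ls) * sqrt (\<kappa> (L t) * (1 + V t) / (2 * (1 - V t)))"
        using p_eq2 m.tau_inv(1)[OF t] by (simp add: F_def)
      have "\<bar>q (t - ls)\<bar> \<le> 1" "V t \<noteq> 0 \<longrightarrow> \<bar>q (t - ls)\<bar> = 1"
        using q(4,5) L_late(2) 2 by auto
      then have "front_speed (2 * (p (t - L t))\<^sup>2) (\<kappa> (L t)) = V t"
        using p \<kappa>_pos[of "L t"] m.L_pos[OF t] m.V_bounds[OF t]
        by (subst front_speed_iff) auto
      then show ?thesis by simp
    next
      case 3
      then have L: "L t = lb0" "V t = 0" using L_end[of t] t by (auto simp: B_def)
      then have "p (t - L t) = ym (t - L t - A)"
        using p_eq3[of "t - L t"] 3 t AB by (auto simp: A_def B_def)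
      moreover have "t - L t - A \<in> {0..lb0}" using 3 t L by (auto simp: A_def B_def)
      ultimately show ?thesis using ym_bound L by simp
    qed
  qed
  interpret c: prescribed_front T l0 L V \<kappa> c1 p y0 y1
  proof
    \<comment> \<open>The compatibility condition is stated with the speed law at \<open>l0\<close>;
      the law at time 0 identifies that speed as \<open>V 0\<close>.\<close>
    show "y1 l0 = - V 0 * deriv_on {0..l0} y0 l0"
      using assms(9) V_eq[of 0] m.T_pos m.L_0 \<open>0 < l0\<close>
      by (simp add: p_eq1 w0_def power_divide)
  qed (use assms \<kappa> V_eq p_cont p_eq1 in \<open>auto simp: w0_def\<close>)
  have p_mid: "p (T - 2 * lb0 + x) = - (yb1 x + deriv_on {0..lb0} yb0 x) / 2" if "x \<in> {0..lb0}" for x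
    using p_eq3[of "A + x"] that AB by (simp add: ym_def A_def)
  have p_end: "p (T - x) = (yb1 x - deriv_on {0..lb0} yb0 x) / 2" if "x \<in> {0..lb0}" for x
    using p_eq4[of "T - x"] that by (simp add: yp_def B_def)
  have l0_lb0: "l0 \<le> lb0" "2 * lb0 < T" using ls assms(16) by auto
  note terminal = c.terminal_state[OF \<open>0 < lb0\<close> l0_lb0 L_end \<open>C1_on {0..lb0} yb0\<close> \<open>yb0 lb0 = 0\<close>
      p_mid p_end]
  \<comment> \<open>For any solution with this control, uniqueness equates front, domain and
    displacement with the constructed ones, so its terminal state is the target.\<close>
  have "L2 T = lb0 \<and> (\<forall>x\<in>{0..lb0}. z T x = yb0 x) \<and>
      (\<forall>x\<in>{0..lb0}. partial_t (debonding_domain T L2) z T x = yb1 x)"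
    if sol: "C1_debonding_solution \<kappa> T l0 y0 y1 c.u L2 z" for L2 z
  proof -
    note unique = C1_debonding_solution_unique[OF c.solution sol assms(11,5,1) \<kappa> lip]
    have "L2 T = lb0" using unique(1)[of T] assms(11) L_B by simp
    moreover have "z T x = yb0 x" if x: "x \<in> {0..lb0}" for x
      using terminal(1)[OF _ _ _ _ x] unique(3)[of T x] x assms(11) L_B
      by (simp add: debonding_domain_def)
    moreover have "partial_t (debonding_domain T L2) z T x = yb1 x" if x: "x \<in> {0..lb0}" for x
      using terminal(2)[OF _ _ _ _ x, of z] unique(2,3) by simp
    ultimately show ?thesis by blast
  qed
  then show ?thesis
    using c.u_C1 c.solution by blast
qed

end
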